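(* Let $f:\mathbb{R}\to\mathbb{R}$ be locally Lipschitz continuous with $f(0)=0$ and $xf(x)>0$ for all $x\neq 0$. Suppose that there exists an odd function $\phi$ on $\mathbb{R}$ such that $\lim_{x\to 0} f(x)/\phi(x)=1$, that $f\in \mathrm{RV}_0(\beta)$ for some $\beta>1$, and that $\lim_{x\to 0^+} f(x)/x=0$. Let $\sigma:[0,\infty)\to\mathbb{R}$ be continuous, and let $X$ be the continuous adapted process which obeys $$dX(t)=-f(X(t))\,dt+\sigma(t)\,dB(t),\quad t\ge 0;\qquad X(0)=\xi,$$ with $\xi\in\mathbb{R}$ deterministic. Then the following are equivalent: (a) $\sigma\in L^2([0,\infty);\mathbb{R})$ and $$\lim_{t\to\infty}\frac{\int_t^\infty\sigma(s)\,dB(s)}{F^{-1}(t)}=0,\quad\text{a.s.};$$ (b) $$\mathbb{P}\left[\lim_{t\to\infty}\frac{X(t)}{F^{-1}(t)} \text{ exists and lies in } (-\infty,\infty)\right]=1;$$ (c) $$\mathbb{P}\left[\lim_{t\to\infty}\frac{X(t)}{F^{-1}(t)}\text{ exists and lies in }\{-1,0,1\}\right]=1.$$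
   Context: $B$ is a one-dimensional standard Brownian motion on a complete probability space $(\Omega,\mathcal{F},\mathbb{P})$, with filtration $(\mathcal{F}^B(t))_{t\ge0}$ the natural filtration generated by $B$. A function $f$ which is positive and measurable on $(0,\infty)$ is regularly varying at $0$ with index $\beta\in\mathbb{R}$, written $f\in\mathrm{RV}_0(\beta)$, if $\lim_{x\to0^+} f(\lambda x)/f(x)=\lambda^\beta$ for every $\lambda>0$ (for $f$ defined on $\mathbb{R}$ this refers to its restriction to $(0,\infty)$). Define $F(x)=\int_x^1 \frac{1}{f(u)}\,du$ for $x>0$. $F$ is strictly decreasing; since $\beta>1$, $F(x)\to\infty$ as $x\to0^+$. $F^{-1}$ denotes the inverse function of $F$; $F^{-1}(t)>0$ is defined for all $t\ge 0$ and tends to $0$ as $t\to\infty$. When $\sigma\in L^2([0,\infty);\mathbb{R})$, $\int_0^T\sigma(s)\,dB(s)$ converges a.s. as $T\to\infty$, and on the corresponding a.s. event $\int_t^\infty\sigma(s)\,dB(s):=\lim_{T\to\infty}\int_0^T\sigma(s)\,dB(s)-\int_0^t\sigma(s)\,dB(s)$ for all $t\ge0$. *)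

theory Defs
  imports "HOL-Probability.Probability"
begin

section \<open>Brownian motion and its filtration\<close>

text \<open>Processes are functions on the whole real line of times; only the values at times
  \<open>t \<ge> 0\<close> are ever constrained or used.\<close>

definition standard_brownian_motion :: "'a measure \<Rightarrow> (real \<Rightarrow> 'a \<Rightarrow> real) \<Rightarrow> bool" where
  "standard_brownian_motion M B \<longleftrightarrow>
     (\<forall>t\<ge>0. B t \<in> borel_measurable M) \<and>
     (AE \<omega> in M. B 0 \<omega> = 0) \<and>
     (\<forall>(n::nat) (\<tau>::nat \<Rightarrow> real). 0 \<le> \<tau> 0 \<longrightarrow> mono_on {..n} \<tau> \<longrightarrow>
        prob_space.indep_vars M (\<lambda>_. borel) (\<lambda>i \<omega>. B (\<tau> (Suc i)) \<omega> - B (\<tau> i) \<omega>) {..<n}) \<and>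
     (\<forall>s t. 0 \<le> s \<longrightarrow> s < t \<longrightarrow>
        distributed M lborel (\<lambda>\<omega>. B t \<omega> - B s \<omega>)
          (\<lambda>x. ennreal (normal_density 0 (sqrt (t - s)) x))) \<and>
     (AE \<omega> in M. continuous_on {0..} (\<lambda>t. B t \<omega>))"

text \<open>The natural filtration of \<open>B\<close>, augmented by the null sets of \<open>M\<close>. The augmentation is
  needed for the stochastic integral, which is only determined up to null sets, to be adapted.\<close>

definition brownian_filtration :: "'a measure \<Rightarrow> (real \<Rightarrow> 'a \<Rightarrow> real) \<Rightarrow> real \<Rightarrow> 'a measure" where
  "brownian_filtration M B t =
     sigma (space M) ({B s -` A \<inter> space M | s A. 0 \<le> s \<and> s \<le> t \<and> A \<in> sets borel} \<union> null_sets M)"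

definition continuous_adapted :: "'a measure \<Rightarrow> (real \<Rightarrow> 'a \<Rightarrow> real) \<Rightarrow> (real \<Rightarrow> 'a \<Rightarrow> real) \<Rightarrow> bool" where
  "continuous_adapted M B Y \<longleftrightarrow>
     (\<forall>t\<ge>0. Y t \<in> borel_measurable (brownian_filtration M B t)) \<and>
     (AE \<omega> in M. continuous_on {0..} (\<lambda>t. Y t \<omega>))"


section \<open>The stochastic integral of a deterministic integrand\<close>

definition step_fun :: "nat \<Rightarrow> (nat \<Rightarrow> real) \<Rightarrow> (nat \<Rightarrow> real) \<Rightarrow> real \<Rightarrow> real" where
  "step_fun n \<tau> c s = (\<Sum>i<n. c i * indicator {\<tau> i<..\<tau> (Suc i)} s)"

definition step_integral ::
    "(real \<Rightarrow> 'a \<Rightarrow> real) \<Rightarrow> nat \<Rightarrow> (nat \<Rightarrow> real) \<Rightarrow> (nat \<Rightarrow> real) \<Rightarrow> 'a \<Rightarrow> real" where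
  "step_integral B n \<tau> c \<omega> = (\<Sum>i<n. c i * (B (\<tau> (Suc i)) \<omega> - B (\<tau> i) \<omega>))"

text \<open>\<open>Y\<close> is (a version of) the Ito integral of \<open>\<sigma>\<close> over \<open>[0, t]\<close>: the limit in \<open>L\<^sup>2(M)\<close> of the
  integrals of step functions which approximate \<open>\<sigma>\<close> in \<open>L\<^sup>2([0, t])\<close>. By the Ito isometry the
  limit does not depend on the approximating sequence. For deterministic integrands
  deterministic step functions suffice.\<close>

definition is_ito_integral ::
    "'a measure \<Rightarrow> (real \<Rightarrow> 'a \<Rightarrow> real) \<Rightarrow> (real \<Rightarrow> real) \<Rightarrow> real \<Rightarrow> ('a \<Rightarrow> real) \<Rightarrow> bool" where
  "is_ito_integral M B \<sigma> t Y \<longleftrightarrow>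
     Y \<in> borel_measurable M \<and>
     (\<exists>(n :: nat \<Rightarrow> nat) (\<tau> :: nat \<Rightarrow> nat \<Rightarrow> real) (c :: nat \<Rightarrow> nat \<Rightarrow> real).
        (\<forall>k. 0 \<le> \<tau> k 0 \<and> mono_on {..n k} (\<tau> k) \<and> \<tau> k (n k) \<le> t) \<and>
        (\<lambda>k. \<integral>\<^sup>+s\<in>{0..t}. ennreal ((step_fun (n k) (\<tau> k) (c k) s - \<sigma> s)\<^sup>2) \<partial>lborel)
          \<longlonglongrightarrow> 0 \<and>
        (\<lambda>k. \<integral>\<^sup>+\<omega>. ennreal ((step_integral B (n k) (\<tau> k) (c k) \<omega> - Y \<omega>)\<^sup>2) \<partial>M)
          \<longlonglongrightarrow> 0)"

text \<open>\<open>I\<close> is the continuous process \<open>t \<mapsto> \<integral>\<^sub>0\<^sup>t \<sigma>(s) dB(s)\<close>; it is unique up to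
  indistinguishability.\<close>

definition ito_integral_process ::
    "'a measure \<Rightarrow> (real \<Rightarrow> 'a \<Rightarrow> real) \<Rightarrow> (real \<Rightarrow> real) \<Rightarrow> (real \<Rightarrow> 'a \<Rightarrow> real) \<Rightarrow> bool" where
  "ito_integral_process M B \<sigma> I \<longleftrightarrow>
     (\<forall>t\<ge>0. is_ito_integral M B \<sigma> t (I t)) \<and>
     (AE \<omega> in M. continuous_on {0..} (\<lambda>t. I t \<omega>))"

text \<open>The tail \<open>\<integral>\<^sub>t\<^sup>\<infinity> \<sigma>(s) dB(s)\<close>, where \<open>I\<close> is the integral process; meaningful at those
  \<open>\<omega>\<close> for which \<open>I T \<omega>\<close> converges as \<open>T \<rightarrow> \<infinity>\<close>.\<close>

definition ito_tail :: "(real \<Rightarrow> 'a \<Rightarrow> real) \<Rightarrow> real \<Rightarrow> 'a \<Rightarrow> real" where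
  "ito_tail I t \<omega> = Lim at_top (\<lambda>T. I T \<omega>) - I t \<omega>"

text \<open>\<open>X\<close> is a continuous adapted solution of \<open>dX = -f(X) dt + \<sigma> dB\<close>, \<open>X(0) = \<xi>\<close>, where \<open>I\<close> is
  the integral process of \<open>\<sigma>\<close> with respect to \<open>B\<close>.\<close>

definition sde_solution ::
    "'a measure \<Rightarrow> (real \<Rightarrow> 'a \<Rightarrow> real) \<Rightarrow> (real \<Rightarrow> 'a \<Rightarrow> real) \<Rightarrow> (real \<Rightarrow> real) \<Rightarrow> real
      \<Rightarrow> (real \<Rightarrow> 'a \<Rightarrow> real) \<Rightarrow> bool" where
  "sde_solution M B I f \<xi> X \<longleftrightarrow>
     continuous_adapted M B X \<and>
     (AE \<omega> in M. X 0 \<omega> = \<xi>) \<and>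
     (AE \<omega> in M. \<forall>t\<ge>0. X t \<omega> = \<xi> - (LINT s:{0..t}|lborel. f (X s \<omega>)) + I t \<omega>)"


section \<open>Regular variation at zero and the scale function\<close>

definition RV0 :: "real \<Rightarrow> (real \<Rightarrow> real) set" where
  "RV0 \<beta> = {f. (\<forall>x>0. f x > 0) \<and>
     f \<in> borel_measurable (restrict_space borel {0<..}) \<and>
     (\<forall>c>0. ((\<lambda>x. f (c * x) / f x) \<longlongrightarrow> c powr \<beta>) (at_right 0))}"

text \<open>The interval integral is oriented, so this is negative for \<open>x > 1\<close>.\<close>

definition scale_fun :: "(real \<Rightarrow> real) \<Rightarrow> real \<Rightarrow> real" where
  "scale_fun f x = (LBINT u=ereal x..ereal 1. 1 / f u)"

definition scale_inv :: "(real \<Rightarrow> real) \<Rightarrow> real \<Rightarrow> real" where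
  "scale_inv f t = the_inv_into {0<..} (scale_fun f) t"

end

theory Submission
  imports Defs
begin

text \<open>
  Write \<open>g = F\<^sup>-\<^sup>1\<close>, so that \<open>g' = - f g\<close> and \<open>g\<close> decreases to 0, and let
  \<open>N t = \<integral>\<^sub>t\<^sup>\<infinity> \<sigma> dB\<close>. The theorem rests on a pathwise comparison of \<open>X\<close> with \<open>g\<close>, and on the
  Gaussian law of \<open>N\<close> to identify one random limit.

  Pathwise, \<open>Y = X + N\<close> is differentiable and solves \<open>Y' = - f (Y - N)\<close>. Since \<open>f\<close> is regularly
  varying and asymptotically odd, \<open>z = Y / g\<close> follows, in the time scale \<open>- ln g\<close> and up to an
  error that vanishes when \<open>N / g \<rightarrow> 0\<close>, the autonomous equation \<open>z' = z - sgn z \<bar>z\<bar> powr \<beta>\<close>. On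
  the line a solution of such an equation can only converge to an equilibrium, that is to
  \<open>-1\<close>, \<open>0\<close> or \<open>1\<close>, or diverge, and divergence is excluded because \<open>\<beta> > 1\<close>
  (\<open>perturbed_ode_limit\<close>, \<open>no_faster_than_scale\<close>). Thus (a) implies (c). What makes the
  approximation legitimate is that \<open>f (y x) / f x\<close> has a limit jointly in \<open>x \<rightarrow> 0+\<close> and
  \<open>y \<rightarrow> c\<close> (\<open>ratio_tendsto\<close>); as \<open>f\<close> is continuous this follows from Baire's theorem, and its
  global companion is Potter's bound (\<open>potter_bound\<close>).

  Conversely, if \<open>X / g\<close> has a finite limit \<open>L\<close>, then \<open>f X\<close> is comparable to \<open>f g\<close>, which is
  integrable with tail \<open>g\<close>. So \<open>\<integral>\<sigma> dB\<close> converges and \<open>N / g\<close> tends to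
  \<open>\<Lambda> = sgn L \<bar>L\<bar> powr \<beta> - L\<close> (\<open>tail_limit_of_path_limit\<close>). Convergence of a Gaussian process with
  independent increments forces bounded variances, hence \<open>\<sigma> \<in> L\<^sup>2\<close>. Moreover \<open>\<Lambda>\<close> is a limit of
  centred Gaussian variables \<open>D n\<close> which are independent of their neighbours; the variance of
  \<open>D n - D (n + 1)\<close> is the sum of the two variances and tends to 0, hence \<open>\<Lambda> = 0\<close>
  (\<open>normalised_ito_tail_limit_eq_0\<close>). This is (a).
\<close>

section \<open>Gaussian law of integrals of deterministic functions\<close>

lemma (in prob_space) char_centred_normal:
  assumes X: "distributed M lborel X (\<lambda>x. ennreal (normal_density 0 \<sigma> x))" and pos: "0 < \<sigma>"
  shows "char (distr M borel X) t = of_real (exp (- (\<sigma>\<^sup>2 * t\<^sup>2) / 2))"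
proof -
  have Xm [measurable]: "X \<in> borel_measurable M"
    using distributed_measurable[OF X] by simp
  have "distributed M lborel (\<lambda>x. (X x - 0) / \<sigma>) std_normal_density"
    using X normal_standard_normal_convert[OF pos, of X 0] by simp
  then have "distr M lborel (\<lambda>x. X x / \<sigma>) = std_normal_distribution"
    by (simp add: distributed_distr_eq_density)
  moreover have "distr M lborel (\<lambda>x. X x / \<sigma>) = distr M borel (\<lambda>x. X x / \<sigma>)"
    by (intro distr_cong) auto
  ultimately have std: "distr M borel (\<lambda>x. X x / \<sigma>) = std_normal_distribution"
    by simp
  have "char (distr M borel X) t = (CLINT x|M. iexp (t * X x))"
    unfolding char_def by (subst integral_distr) auto
  also have "\<dots> = (CLINT x|M. iexp ((t * \<sigma>) * (X x / \<sigma>)))"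
    using pos by simp
  also have "\<dots> = char (distr M borel (\<lambda>x. X x / \<sigma>)) (t * \<sigma>)"
    unfolding char_def by (subst integral_distr) auto
  also have "\<dots> = of_real (exp (- (\<sigma>\<^sup>2 * t\<^sup>2) / 2))"
    unfolding std char_std_normal_distribution by (simp add: power_mult_distrib mult.commute)
  finally show ?thesis .
qed

lemma (in prob_space) Re_char_eq_expectation_cos:
  assumes [measurable]: "Z \<in> borel_measurable M"
  shows "Re (char (distr M borel Z) 1) = expectation (\<lambda>\<omega>. cos (Z \<omega>))"
proof -
  have "char (distr M borel Z) 1 = (CLINT x|M. iexp (Z x))"
    unfolding char_def by (subst integral_distr) auto
  also have "Re \<dots> = (LINT x|M. Re (iexp (Z x)))"
    by (subst integral_Re) (auto intro!: integrable_iexp)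
  finally show ?thesis by (simp add: Re_exp)
qed

lemma brownian_motion_measurable:
  assumes "standard_brownian_motion M B" "0 \<le> t"
  shows "B t \<in> borel_measurable M"
  using assms by (simp add: standard_brownian_motion_def)

text \<open>Only the symmetric part \<open>E cos Z\<close> of the characteristic function is recorded for Gaussian
  variables: it determines the variance of a centred Gaussian, it is real, and it passes to limits
  by dominated convergence.\<close>

lemma (in prob_space) expectation_cos_step_integral:
  assumes bm: "standard_brownian_motion M B"
    and \<tau>: "0 \<le> \<tau> 0" "mono_on {..n} \<tau>"
  shows "expectation (\<lambda>\<omega>. cos (step_integral B n \<tau> c \<omega>))
    = exp (- (\<Sum>i<n. (c i)\<^sup>2 * (\<tau> (Suc i) - \<tau> i)) / 2)"
proof -
  have nonneg: "0 \<le> \<tau> i" if "i \<le> n" for i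
    using \<tau> that by (meson atMost_iff le0 mono_onD order_trans)
  have [measurable]: "B (\<tau> i) \<in> borel_measurable M" if "i \<le> n" for i
    using brownian_motion_measurable[OF bm nonneg[OF that]] .
  have indep: "indep_vars (\<lambda>_. borel) (\<lambda>i \<omega>. B (\<tau> (Suc i)) \<omega> - B (\<tau> i) \<omega>) {..<n}"
    using bm \<tau> unfolding standard_brownian_motion_def by blast
  have indep': "indep_vars (\<lambda>_. borel) (\<lambda>i \<omega>. c i * (B (\<tau> (Suc i)) \<omega> - B (\<tau> i) \<omega>)) {..<n}"
    by (rule indep_vars_compose2[OF indep, where Y="\<lambda>i x. c i * x"]) auto
  have factor: "char (distr M borel (\<lambda>\<omega>. c i * (B (\<tau> (Suc i)) \<omega> - B (\<tau> i) \<omega>))) 1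
      = of_real (exp (- ((c i)\<^sup>2 * (\<tau> (Suc i) - \<tau> i)) / 2))" if "i < n" for i
  proof (cases "\<tau> i = \<tau> (Suc i)")
    case True
    then show ?thesis
      by (simp add: char_def integral_distr prob_space del: distr_const)
  next
    case False
    then have less: "\<tau> i < \<tau> (Suc i)"
      using mono_onD[OF \<tau>(2), of i "Suc i"] that by simp
    have m: "B (\<tau> i) \<in> borel_measurable M" "B (\<tau> (Suc i)) \<in> borel_measurable M"
      using that by auto
    have d: "distributed M lborel (\<lambda>\<omega>. B (\<tau> (Suc i)) \<omega> - B (\<tau> i) \<omega>)
        (\<lambda>x. ennreal (normal_density 0 (sqrt (\<tau> (Suc i) - \<tau> i)) x))"
      using bm less nonneg[of i] that unfolding standard_brownian_motion_def by auto
    have "char (distr M borel (\<lambda>\<omega>. c i * (B (\<tau> (Suc i)) \<omega> - B (\<tau> i) \<omega>))) 1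
        = char (distr M borel (\<lambda>\<omega>. B (\<tau> (Suc i)) \<omega> - B (\<tau> i) \<omega>)) (c i)"
      unfolding char_def using m by (simp add: integral_distr)
    also have "\<dots> = of_real (exp (- ((sqrt (\<tau> (Suc i) - \<tau> i))\<^sup>2 * (c i)\<^sup>2) / 2))"
      using less by (intro char_centred_normal[OF d]) auto
    finally show ?thesis using less by (simp add: mult.commute)
  qed
  have "char (distr M borel (step_integral B n \<tau> c)) 1
      = (\<Prod>i<n. char (distr M borel (\<lambda>\<omega>. c i * (B (\<tau> (Suc i)) \<omega> - B (\<tau> i) \<omega>))) 1)"
    unfolding step_integral_def[abs_def] by (rule char_distr_sum[OF indep'])
  also have "\<dots> = of_real (\<Prod>i<n. exp (- ((c i)\<^sup>2 * (\<tau> (Suc i) - \<tau> i)) / 2))"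
    by (simp add: factor)
  also have "(\<Prod>i<n. exp (- ((c i)\<^sup>2 * (\<tau> (Suc i) - \<tau> i)) / 2))
      = exp (\<Sum>i<n. - ((c i)\<^sup>2 * (\<tau> (Suc i) - \<tau> i)) / 2)"
    by (simp add: exp_sum)
  also have "(\<Sum>i<n. - ((c i)\<^sup>2 * (\<tau> (Suc i) - \<tau> i)) / 2)
      = - (\<Sum>i<n. (c i)\<^sup>2 * (\<tau> (Suc i) - \<tau> i)) / 2"
    by (simp add: sum_negf sum_divide_distrib)
  finally have "Re (char (distr M borel (step_integral B n \<tau> c)) 1)
      = exp (- (\<Sum>i<n. (c i)\<^sup>2 * (\<tau> (Suc i) - \<tau> i)) / 2)"
    by simp
  moreover have "step_integral B n \<tau> c \<in> borel_measurable M"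
    unfolding step_integral_def[abs_def]
    by (intro borel_measurable_sum borel_measurable_times borel_measurable_diff) auto
  ultimately show ?thesis
    by (simp add: Re_char_eq_expectation_cos)
qed

lemma step_fun_eq_0:
  assumes "mono_on {..n} \<tau>" "s \<le> \<tau> 0 \<or> \<tau> n < s"
  shows "step_fun n \<tau> c s = 0"
proof -
  have "s \<notin> {\<tau> i<..\<tau> (Suc i)}" if "i < n" for i
    using assms(2) mono_onD[OF assms(1), of 0 i] mono_onD[OF assms(1), of "Suc i" n] that by auto
  then show ?thesis by (auto simp: step_fun_def)
qed

lemma has_bochner_integral_step_fun_squared:
  assumes "mono_on {..n} \<tau>"
  shows "has_bochner_integral lborel (\<lambda>s. (step_fun n \<tau> c s)\<^sup>2)
    (\<Sum>i<n. (c i)\<^sup>2 * (\<tau> (Suc i) - \<tau> i))"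
  using assms
proof (induction n)
  case 0
  have "has_bochner_integral lborel (\<lambda>s::real. 0::real) 0" by (rule has_bochner_integral_zero)
  then show ?case by (simp add: step_fun_def)
next
  case (Suc n)
  have mono: "mono_on {..n} \<tau>"
    using Suc.prems by (rule mono_on_subset) auto
  have sq: "(step_fun (Suc n) \<tau> c s)\<^sup>2
      = (step_fun n \<tau> c s)\<^sup>2 + (c n)\<^sup>2 * indicator {\<tau> n<..\<tau> (Suc n)} s" for s
  proof (cases "\<tau> n < s")
    case True
    then have "step_fun n \<tau> c s = 0" using mono by (simp add: step_fun_eq_0)
    then show ?thesis
      by (simp add: step_fun_def power_mult_distrib indicator_def)
  qed (simp add: step_fun_def)
  have le: "\<tau> n \<le> \<tau> (Suc n)" using mono_onD[OF Suc.prems, of n "Suc n"] by simp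
  have "has_bochner_integral lborel (\<lambda>s. (c n)\<^sup>2 * indicator {\<tau> n<..\<tau> (Suc n)} s)
      ((c n)\<^sup>2 * (\<tau> (Suc n) - \<tau> n))"
    using has_bochner_integral_real_indicator[of "{\<tau> n<..\<tau> (Suc n)}" lborel] le
    by (intro has_bochner_integral_mult_right) (simp add: measure_def)
  from has_bochner_integral_add[OF Suc.IH[OF mono] this] show ?case
    by (simp add: sq)
qed

text \<open>Pairs \<open>(h, Z)\<close> with \<open>h\<close> a deterministic step function and \<open>Z = \<integral>h dB\<close>. The steps
  \<open>(\<tau> i, \<tau> (i + 1)]\<close> of different step functions do not match, but every step function is a
  combination of the indicators of \<open>(0, x]\<close>. Building pairs from these makes closure under linear
  combinations immediate; a common grid is needed only once, to compute the law of \<open>Z\<close>. The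
  increment \<open>B x - B 0\<close> is used in place of \<open>B x\<close> so that the identities hold for every \<open>\<omega>\<close>, not
  just where \<open>B 0 \<omega> = 0\<close>.\<close>

inductive elementary_pair ::
  "(real \<Rightarrow> 'a \<Rightarrow> real) \<Rightarrow> (real \<Rightarrow> real) \<Rightarrow> ('a \<Rightarrow> real) \<Rightarrow> bool" for B where
  zero: "elementary_pair B (\<lambda>_. 0) (\<lambda>_. 0)"
| add_term: "elementary_pair B h Z \<Longrightarrow> 0 \<le> x \<Longrightarrow>
    elementary_pair B (\<lambda>s. h s + c * indicator {0<..x} s) (\<lambda>\<omega>. Z \<omega> + c * (B x \<omega> - B 0 \<omega>))"

lemma elementary_pair_scale:
  assumes "elementary_pair B h Z"
  shows "elementary_pair B (\<lambda>s. a * h s) (\<lambda>\<omega>. a * Z \<omega>)"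
  using assms
proof induction
  case (add_term h Z x c)
  from elementary_pair.add_term[OF add_term.IH add_term.hyps(2), of "a * c"] show ?case
    by (simp add: algebra_simps)
qed (simp add: elementary_pair.zero)

lemma elementary_pair_add:
  assumes "elementary_pair B h' Z'" "elementary_pair B h Z"
  shows "elementary_pair B (\<lambda>s. h s + h' s) (\<lambda>\<omega>. Z \<omega> + Z' \<omega>)"
  using assms
proof induction
  case (add_term h' Z' x c)
  from elementary_pair.add_term[OF add_term.IH[OF add_term.prems] add_term.hyps(2), of c] show ?case
    by (simp add: add.assoc)
qed simp

lemma elementary_pair_step:
  assumes "0 \<le> \<tau> 0" "mono_on {..n} \<tau>"
  shows "elementary_pair B (step_fun n \<tau> c) (step_integral B n \<tau> c)"
  using assms
proof (induction n)
  case 0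
  then show ?case
    using elementary_pair.zero by (simp add: step_fun_def[abs_def] step_integral_def[abs_def])
next
  case (Suc n)
  have mono: "mono_on {..n} \<tau>"
    using Suc.prems(2) by (rule mono_on_subset) auto
  have le: "0 \<le> \<tau> n" "\<tau> n \<le> \<tau> (Suc n)"
    using mono_onD[OF Suc.prems(2), of n "Suc n"] mono_onD[OF Suc.prems(2), of 0 n] Suc.prems(1)
    by auto
  have "elementary_pair B (\<lambda>s. step_fun n \<tau> c s + c n * indicator {0<..\<tau> (Suc n)} s
        + (- c n) * indicator {0<..\<tau> n} s)
      (\<lambda>\<omega>. step_integral B n \<tau> c \<omega> + c n * (B (\<tau> (Suc n)) \<omega> - B 0 \<omega>)
        + (- c n) * (B (\<tau> n) \<omega> - B 0 \<omega>))"
    using Suc.IH[OF Suc.prems(1) mono] le by (intro elementary_pair.add_term) auto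
  moreover have "(\<lambda>s. step_fun n \<tau> c s + c n * indicator {0<..\<tau> (Suc n)} s
        + (- c n) * indicator {0<..\<tau> n} s) = step_fun (Suc n) \<tau> c"
    using le by (auto simp: step_fun_def fun_eq_iff indicator_def)
  moreover have "(\<lambda>\<omega>. step_integral B n \<tau> c \<omega> + c n * (B (\<tau> (Suc n)) \<omega> - B 0 \<omega>)
        + (- c n) * (B (\<tau> n) \<omega> - B 0 \<omega>)) = step_integral B (Suc n) \<tau> c"
    by (simp add: step_integral_def fun_eq_iff algebra_simps)
  ultimately show ?case by simp
qed

lemma initial_segment_as_step:
  assumes "\<tau> 0 = 0" "mono_on {..m} \<tau>"
  shows "(\<Sum>i<m. c * indicator {\<tau> i<..\<tau> (Suc i)} s) = (c::real) * indicator {0<..\<tau> m} (s::real)"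
  using assms(2)
proof (induction m)
  case (Suc m)
  have "mono_on {..m} \<tau>" using Suc.prems by (rule mono_on_subset) auto
  moreover have "\<tau> m \<le> \<tau> (Suc m)" "0 \<le> \<tau> m"
    using mono_onD[OF Suc.prems, of m "Suc m"] mono_onD[OF Suc.prems, of 0 m] assms(1) by auto
  ultimately show ?case using Suc.IH by (auto simp: indicator_def)
qed (simp add: assms(1))

text \<open>Any grid that contains the finitely many endpoints used in building the pair will do. Allowing
  all such grids, and not one chosen for the pair, is what lets the induction add a new endpoint.\<close>

lemma elementary_pair_on_grid:
  assumes "elementary_pair B h Z"
  shows "\<exists>S. finite S \<and> S \<subseteq> {0..} \<and> (\<forall>n \<tau>. \<tau> 0 = 0 \<and> mono_on {..n} \<tau> \<and> S \<subseteq> \<tau> ` {..n} \<longrightarrow>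
    (\<exists>d. h = step_fun n \<tau> d \<and> Z = step_integral B n \<tau> d))"
  using assms
proof induction
  case zero
  have "(\<lambda>_. 0) = step_fun n \<tau> (\<lambda>_. 0)" "(\<lambda>_. 0) = step_integral B n \<tau> (\<lambda>_. 0)" for n \<tau>
    by (auto simp: step_fun_def step_integral_def)
  then have "\<exists>d. (\<lambda>_. 0) = step_fun n \<tau> d \<and> (\<lambda>_. 0) = step_integral B n \<tau> d" for n \<tau>
    by metis
  then show ?case by (intro exI[of _ "{}"]) auto
next
  case (add_term h Z x c)
  then obtain S where S: "finite S" "S \<subseteq> {0..}"
    "\<forall>n \<tau>. \<tau> 0 = 0 \<and> mono_on {..n} \<tau> \<and> S \<subseteq> \<tau> ` {..n} \<longrightarrow>
      (\<exists>d. h = step_fun n \<tau> d \<and> Z = step_integral B n \<tau> d)"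
    by auto
  have "\<exists>d. (\<lambda>s. h s + c * indicator {0<..x} s) = step_fun n \<tau> d \<and>
      (\<lambda>\<omega>. Z \<omega> + c * (B x \<omega> - B 0 \<omega>)) = step_integral B n \<tau> d"
    if \<tau>: "\<tau> 0 = 0" "mono_on {..n} \<tau>" "insert x S \<subseteq> \<tau> ` {..n}" for n \<tau>
  proof -
    obtain d where d: "h = step_fun n \<tau> d" "Z = step_integral B n \<tau> d"
      using S(3)[rule_format, of \<tau> n] \<tau> by auto
    obtain m where m: "m \<le> n" "x = \<tau> m" using \<tau>(3) by auto
    define e where "e i = (if i < m then c else 0)" for i
    have restrict: "(\<Sum>i<n. e i * u i) = (\<Sum>i<m. c * u i)" for u :: "nat \<Rightarrow> real"
      using m(1) unfolding e_def by (intro sum.mono_neutral_cong_right) auto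
    have "mono_on {..m} \<tau>" using \<tau>(2) by (rule mono_on_subset) (use m in auto)
    then have ind: "(\<Sum>i<n. e i * indicator {\<tau> i<..\<tau> (Suc i)} s) = c * indicator {0<..x} s" for s
      using initial_segment_as_step[of \<tau> m c s] \<tau>(1) m(2) by (simp add: restrict)
    have "(\<Sum>i<n. e i * (B (\<tau> (Suc i)) \<omega> - B (\<tau> i) \<omega>)) = c * (B x \<omega> - B 0 \<omega>)" for \<omega>
      using sum_lessThan_telescope[of "\<lambda>i. B (\<tau> i) \<omega>" m] \<tau>(1) m(2)
      by (simp add: restrict flip: sum_distrib_left)
    then have "(\<lambda>s. h s + c * indicator {0<..x} s) = step_fun n \<tau> (\<lambda>i. d i + e i)"
      "(\<lambda>\<omega>. Z \<omega> + c * (B x \<omega> - B 0 \<omega>)) = step_integral B n \<tau> (\<lambda>i. d i + e i)"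
      using ind by (simp_all add: d step_fun_def step_integral_def distrib_right sum.distrib fun_eq_iff)
    then show ?thesis by blast
  qed
  then show ?case
    using S(1,2) add_term.hyps(2) by (intro exI[of _ "insert x S"]) auto
qed

lemma elementary_pair_as_step:
  assumes "elementary_pair B h Z"
  obtains n \<tau> d where "\<tau> 0 = 0" "mono_on {..n} \<tau>"
    "h = step_fun n \<tau> d" "Z = step_integral B n \<tau> d"
proof -
  obtain S where S: "finite S" "S \<subseteq> {0..}"
    "\<forall>n \<tau>. \<tau> 0 = 0 \<and> mono_on {..n} \<tau> \<and> S \<subseteq> \<tau> ` {..n} \<longrightarrow>
      (\<exists>d. h = step_fun n \<tau> d \<and> Z = step_integral B n \<tau> d)"
    using elementary_pair_on_grid[OF assms] by blast
  define xs where "xs = sorted_list_of_set (insert 0 S)"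
  have set: "set xs = insert 0 S" and sorted: "sorted xs" using S(1) unfolding xs_def by (auto simp del: sorted_list_of_set_insert_remove)
  then have len: "0 < length xs" by auto
  define n where "n = length xs - 1"
  have mono: "mono_on {..n} (\<lambda>i. xs ! i)"
    using sorted len by (intro mono_onI sorted_nth_mono) (auto simp: n_def simp del: length_greater_0_conv)
  have "xs ! 0 \<le> 0"
  proof -
    obtain i where "i < length xs" "xs ! i = 0" using set by (metis in_set_conv_nth insertI1)
    then show ?thesis using sorted_nth_mono[OF sorted, of 0 i] by simp
  qed
  moreover have "0 \<le> xs ! 0" using nth_mem[OF len] set S(2) by auto
  moreover have "S \<subseteq> (\<lambda>i. xs ! i) ` {..n}"
  proof
    fix x assume "x \<in> S"
    then obtain i where "i < length xs" "xs ! i = x" using set by (metis in_set_conv_nth insertI2)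
    then show "x \<in> (\<lambda>i. xs ! i) ` {..n}" by (intro image_eqI[of _ _ i]) (auto simp: n_def)
  qed
  ultimately show ?thesis using S(3)[rule_format, of "\<lambda>i. xs ! i" n] mono that by (metis order_antisym)
qed

lemma (in prob_space) elementary_pair_gaussian:
  assumes "standard_brownian_motion M B" "elementary_pair B h Z"
  shows "Z \<in> borel_measurable M" "integrable lborel (\<lambda>s. (h s)\<^sup>2)" "h \<in> borel_measurable borel"
    "expectation (\<lambda>\<omega>. cos (Z \<omega>)) = exp (- (LINT s|lborel. (h s)\<^sup>2) / 2)"
proof -
  obtain n \<tau> d where s: "\<tau> 0 = 0" "mono_on {..n} \<tau>" "h = step_fun n \<tau> d" "Z = step_integral B n \<tau> d"
    using elementary_pair_as_step[OF assms(2)] by blast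
  have nonneg: "0 \<le> \<tau> i" if "i \<le> n" for i
    using mono_onD[OF s(2), of 0 i] that s(1) by simp
  show "Z \<in> borel_measurable M"
    unfolding s(4) step_integral_def[abs_def]
    by (intro borel_measurable_sum borel_measurable_times borel_measurable_diff
        brownian_motion_measurable[OF assms(1)] nonneg) auto
  show "h \<in> borel_measurable borel" unfolding s(3) step_fun_def[abs_def] by measurable
  note i = has_bochner_integral_step_fun_squared[OF s(2), of d]
  show "integrable lborel (\<lambda>s. (h s)\<^sup>2)"
    using i s(3) by (simp add: has_bochner_integral_iff)
  show "expectation (\<lambda>\<omega>. cos (Z \<omega>)) = exp (- (LINT s|lborel. (h s)\<^sup>2) / 2)"
    using expectation_cos_step_integral[OF assms(1) _ s(2), of d] i s(1,3,4)
    by (simp add: has_bochner_integral_iff)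
qed


lemma tendsto_nn_integral_square_combine:
  assumes meas [measurable]: "\<And>k::nat. u k \<in> borel_measurable N" "\<And>k. v k \<in> borel_measurable N"
    and u: "(\<lambda>k. \<integral>\<^sup>+x. ennreal ((u k x)\<^sup>2) \<partial>N) \<longlonglongrightarrow> 0"
    and v: "(\<lambda>k. \<integral>\<^sup>+x. ennreal ((v k x)\<^sup>2) \<partial>N) \<longlonglongrightarrow> 0"
  shows "(\<lambda>k. \<integral>\<^sup>+x. ennreal ((a * u k x + b * v k x)\<^sup>2) \<partial>N) \<longlonglongrightarrow> 0"
proof (rule tendsto_sandwich[where f="\<lambda>_. 0"])
  show "\<forall>\<^sub>F k in sequentially. (\<integral>\<^sup>+x. ennreal ((a * u k x + b * v k x)\<^sup>2) \<partial>N)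
      \<le> ennreal (2 * a\<^sup>2) * (\<integral>\<^sup>+x. ennreal ((u k x)\<^sup>2) \<partial>N)
        + ennreal (2 * b\<^sup>2) * (\<integral>\<^sup>+x. ennreal ((v k x)\<^sup>2) \<partial>N)"
  proof (rule always_eventually, rule allI)
    fix k
    have "(\<integral>\<^sup>+x. ennreal ((a * u k x + b * v k x)\<^sup>2) \<partial>N)
      \<le> (\<integral>\<^sup>+x. ennreal (2 * a\<^sup>2) * ennreal ((u k x)\<^sup>2) + ennreal (2 * b\<^sup>2) * ennreal ((v k x)\<^sup>2) \<partial>N)"
    proof (rule nn_integral_mono)
      fix x
      have "(a * u k x + b * v k x)\<^sup>2 \<le> 2 * a\<^sup>2 * (u k x)\<^sup>2 + 2 * b\<^sup>2 * (v k x)\<^sup>2"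
        using sum_squares_bound[of "a * u k x" "b * v k x"]
        by (simp add: power2_sum power_mult_distrib)
      then show "ennreal ((a * u k x + b * v k x)\<^sup>2)
          \<le> ennreal (2 * a\<^sup>2) * ennreal ((u k x)\<^sup>2) + ennreal (2 * b\<^sup>2) * ennreal ((v k x)\<^sup>2)"
        by (simp add: ennreal_leI flip: ennreal_mult ennreal_plus)
    qed
    also have "\<dots> = ennreal (2 * a\<^sup>2) * (\<integral>\<^sup>+x. ennreal ((u k x)\<^sup>2) \<partial>N)
        + ennreal (2 * b\<^sup>2) * (\<integral>\<^sup>+x. ennreal ((v k x)\<^sup>2) \<partial>N)"
      by (simp add: nn_integral_add nn_integral_cmult)
    finally show "(\<integral>\<^sup>+x. ennreal ((a * u k x + b * v k x)\<^sup>2) \<partial>N)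
      \<le> ennreal (2 * a\<^sup>2) * (\<integral>\<^sup>+x. ennreal ((u k x)\<^sup>2) \<partial>N)
        + ennreal (2 * b\<^sup>2) * (\<integral>\<^sup>+x. ennreal ((v k x)\<^sup>2) \<partial>N)" .
  qed
  have "(\<lambda>k. ennreal (2 * a\<^sup>2) * (\<integral>\<^sup>+x. ennreal ((u k x)\<^sup>2) \<partial>N)
        + ennreal (2 * b\<^sup>2) * (\<integral>\<^sup>+x. ennreal ((v k x)\<^sup>2) \<partial>N))
      \<longlonglongrightarrow> ennreal (2 * a\<^sup>2) * 0 + ennreal (2 * b\<^sup>2) * 0"
    by (intro tendsto_add tendsto_mult_ennreal tendsto_const u v) auto
  then show "(\<lambda>k. ennreal (2 * a\<^sup>2) * (\<integral>\<^sup>+x. ennreal ((u k x)\<^sup>2) \<partial>N)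
        + ennreal (2 * b\<^sup>2) * (\<integral>\<^sup>+x. ennreal ((v k x)\<^sup>2) \<partial>N)) \<longlonglongrightarrow> 0" by simp
qed auto

text \<open>Convergence of norms. The bound \<open>\<bar>p\<^sup>2 - h\<^sup>2\<bar> \<le> \<epsilon> h\<^sup>2 + (1 + 1 / \<epsilon>) (p - h)\<^sup>2\<close> replaces the
  Cauchy-Schwarz inequality.\<close>

lemma tendsto_integral_square_of_L2:
  fixes h :: "'b \<Rightarrow> real"
  assumes meas [measurable]: "\<And>k::nat. p k \<in> borel_measurable N" "h \<in> borel_measurable N"
    and int: "\<And>k. integrable N (\<lambda>x. (p k x)\<^sup>2)" "integrable N (\<lambda>x. (h x)\<^sup>2)"
    and lim: "(\<lambda>k. \<integral>\<^sup>+x. ennreal ((p k x - h x)\<^sup>2) \<partial>N) \<longlonglongrightarrow> 0"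
  shows "(\<lambda>k. LINT x|N. (p k x)\<^sup>2) \<longlonglongrightarrow> (LINT x|N. (h x)\<^sup>2)"
proof (rule LIMSEQ_I)
  fix e :: real assume e: "0 < e"
  define H where "H = (LINT x|N. (h x)\<^sup>2)"
  define \<delta> where "\<delta> k = (LINT x|N. (p k x - h x)\<^sup>2)" for k
  have H: "0 \<le> H" by (simp add: H_def)
  have intd: "integrable N (\<lambda>x. (p k x - h x)\<^sup>2)" for k
  proof (rule Bochner_Integration.integrable_bound)
    show "integrable N (\<lambda>x. 2 * (p k x)\<^sup>2 + 2 * (h x)\<^sup>2)" using int by auto
    have "(p k x - h x)\<^sup>2 \<le> 2 * (p k x)\<^sup>2 + 2 * (h x)\<^sup>2" for x
      using sum_squares_bound[of "p k x" "- h x"] by (simp add: power2_diff)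
    then show "AE x in N. norm ((p k x - h x)\<^sup>2) \<le> norm (2 * (p k x)\<^sup>2 + 2 * (h x)\<^sup>2)"
      by auto
  qed auto
  have "(\<lambda>k. ennreal (\<delta> k)) \<longlonglongrightarrow> ennreal 0"
    using lim by (simp add: nn_integral_eq_integral[OF intd] \<delta>_def)
  then have \<delta>: "\<delta> \<longlonglongrightarrow> 0"
    by (subst (asm) tendsto_ennreal_iff) (auto simp: \<delta>_def)
  define \<epsilon> where "\<epsilon> = e / (2 * (H + 1))"
  have \<epsilon>: "0 < \<epsilon>" "\<epsilon> * H \<le> e / 2" using e H by (auto simp: \<epsilon>_def field_simps)
  have bound: "norm ((LINT x|N. (p k x)\<^sup>2) - H) \<le> \<epsilon> * H + (1 + 1 / \<epsilon>) * \<delta> k" for k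
  proof -
    have pw: "\<bar>(p k x)\<^sup>2 - (h x)\<^sup>2\<bar> \<le> \<epsilon> * (h x)\<^sup>2 + (1 + 1 / \<epsilon>) * (p k x - h x)\<^sup>2" for x
    proof -
      define d where "d = p k x - h x"
      \<comment> \<open>completing the square gives \<open>2 \<bar>h d\<bar> \<le> \<epsilon> h\<^sup>2 + d\<^sup>2 / \<epsilon>\<close>\<close>
      have "0 \<le> (\<epsilon> * \<bar>h x\<bar> - \<bar>d\<bar>)\<^sup>2 / \<epsilon>" using \<epsilon> by simp
      also have "\<dots> = \<epsilon> * (h x)\<^sup>2 + d\<^sup>2 / \<epsilon> - 2 * \<bar>h x * d\<bar>"
        using \<epsilon> by (simp add: power2_diff field_simps power2_eq_square abs_mult)
      finally have "2 * \<bar>h x * d\<bar> \<le> \<epsilon> * (h x)\<^sup>2 + d\<^sup>2 / \<epsilon>" by simp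
      moreover have "(p k x)\<^sup>2 - (h x)\<^sup>2 = 2 * (h x * d) + d\<^sup>2"
        by (simp add: d_def power2_eq_square algebra_simps)
      moreover have "\<bar>2 * (h x * d) + d\<^sup>2\<bar> \<le> 2 * \<bar>h x * d\<bar> + d\<^sup>2"
        by (rule order_trans[OF abs_triangle_ineq]) simp
      ultimately have "\<bar>(p k x)\<^sup>2 - (h x)\<^sup>2\<bar> \<le> \<epsilon> * (h x)\<^sup>2 + d\<^sup>2 / \<epsilon> + d\<^sup>2" by linarith
      then show ?thesis by (simp add: d_def distrib_right)
    qed
    have "norm ((LINT x|N. (p k x)\<^sup>2) - H) = norm (LINT x|N. (p k x)\<^sup>2 - (h x)\<^sup>2)"
      using int by (simp add: H_def)
    also have "\<dots> \<le> (LINT x|N. \<epsilon> * (h x)\<^sup>2 + (1 + 1 / \<epsilon>) * (p k x - h x)\<^sup>2)"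
      using int intd pw by (intro order_trans[OF integral_norm_bound] integral_mono integrable_norm) auto
    also have "\<dots> = \<epsilon> * H + (1 + 1 / \<epsilon>) * \<delta> k"
      using int intd by (simp add: H_def \<delta>_def)
    finally show ?thesis .
  qed
  have "(\<lambda>k. (1 + 1 / \<epsilon>) * \<delta> k) \<longlonglongrightarrow> (1 + 1 / \<epsilon>) * 0" by (intro tendsto_intros \<delta>)
  then have "\<forall>\<^sub>F k in sequentially. (1 + 1 / \<epsilon>) * \<delta> k < e / 2"
    using e by (intro order_tendstoD(2)[where y="(1 + 1 / \<epsilon>) * 0"]) auto
  then obtain n where small: "\<And>k. k \<ge> n \<Longrightarrow> (1 + 1 / \<epsilon>) * \<delta> k < e / 2"
    by (auto simp: eventually_sequentially)
  have "norm ((LINT x|N. (p k x)\<^sup>2) - H) < e" if "k \<ge> n" for k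
    using bound[of k] small[OF that] \<epsilon>(2) by linarith
  then show "\<exists>n. \<forall>k\<ge>n. norm ((LINT x|N. (p k x)\<^sup>2) - (LINT x|N. (h x)\<^sup>2)) < e"
    unfolding H_def by blast
qed

lemma (in prob_space) tendsto_expectation_cos_of_L2:
  fixes Z :: "'a \<Rightarrow> real"
  assumes meas [measurable]: "\<And>k::nat. Y k \<in> borel_measurable M" "Z \<in> borel_measurable M"
    and lim: "(\<lambda>k. \<integral>\<^sup>+x. ennreal ((Y k x - Z x)\<^sup>2) \<partial>M) \<longlonglongrightarrow> 0"
  shows "(\<lambda>k. expectation (\<lambda>\<omega>. cos (Y k \<omega>))) \<longlonglongrightarrow> expectation (\<lambda>\<omega>. cos (Z \<omega>))"
proof (rule LIMSEQ_I)
  fix e :: real assume e: "0 < e"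
  define \<epsilon> where "\<epsilon> = e / 2"
  have \<epsilon>: "0 < \<epsilon>" using e by (simp add: \<epsilon>_def)
  have cosi: "integrable M (\<lambda>\<omega>. cos (V \<omega>))" if [measurable]: "V \<in> borel_measurable M" for V :: "'a \<Rightarrow> real"
    by (rule integrable_const_bound[of _ 1]) auto
  have "\<forall>\<^sub>F k in sequentially. (\<integral>\<^sup>+x. ennreal ((Y k x - Z x)\<^sup>2) \<partial>M) < ennreal (\<epsilon> * \<epsilon>)"
    using \<epsilon> by (intro order_tendstoD(2)[OF lim]) auto
  then obtain n where n: "\<And>k. k \<ge> n \<Longrightarrow> (\<integral>\<^sup>+x. ennreal ((Y k x - Z x)\<^sup>2) \<partial>M) < ennreal (\<epsilon> * \<epsilon>)"
    by (auto simp: eventually_sequentially)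
  have "norm (expectation (\<lambda>\<omega>. cos (Y k \<omega>)) - expectation (\<lambda>\<omega>. cos (Z \<omega>))) < e" if k: "k \<ge> n" for k
  proof -
    have fin: "(\<integral>\<^sup>+x. ennreal ((Y k x - Z x)\<^sup>2) \<partial>M) < \<infinity>"
      using n[OF k] by (rule less_trans) simp
    then have int: "integrable M (\<lambda>x. (Y k x - Z x)\<^sup>2)"
      by (intro integrableI_bounded) auto
    have small: "expectation (\<lambda>x. (Y k x - Z x)\<^sup>2) < \<epsilon> * \<epsilon>"
      using n[OF k] \<epsilon> by (simp add: nn_integral_eq_integral[OF int] ennreal_less_iff)
    have pw: "norm (cos (Y k \<omega>) - cos (Z \<omega>)) \<le> \<epsilon> / 2 + (Y k \<omega> - Z \<omega>)\<^sup>2 / (2 * \<epsilon>)" for \<omega>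
    proof -
      define d where "d = Y k \<omega> - Z \<omega>"
      have "\<bar>cos (Y k \<omega>) - cos (Z \<omega>)\<bar> \<le> \<bar>d\<bar>"
      proof -
        have "\<bar>cos (Y k \<omega>) - cos (Z \<omega>)\<bar> = 2 * \<bar>sin ((Y k \<omega> + Z \<omega>) / 2)\<bar> * \<bar>sin ((Z \<omega> - Y k \<omega>) / 2)\<bar>"
          by (simp add: cos_diff_cos abs_mult)
        also have "\<dots> \<le> 2 * 1 * \<bar>(Z \<omega> - Y k \<omega>) / 2\<bar>"
          by (intro mult_mono abs_sin_x_le_abs_x) auto
        finally show ?thesis by (simp add: d_def abs_minus_commute)
      qed
      moreover have "0 \<le> (\<epsilon> - \<bar>d\<bar>)\<^sup>2 / (2 * \<epsilon>)" using \<epsilon> by simp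
      then have "\<bar>d\<bar> \<le> \<epsilon> / 2 + d\<^sup>2 / (2 * \<epsilon>)"
        using \<epsilon> by (simp add: power2_diff field_simps power2_eq_square)
      ultimately show ?thesis by (simp add: d_def)
    qed
    have "norm (expectation (\<lambda>\<omega>. cos (Y k \<omega>)) - expectation (\<lambda>\<omega>. cos (Z \<omega>)))
        = norm (expectation (\<lambda>\<omega>. cos (Y k \<omega>) - cos (Z \<omega>)))"
      by (simp add: cosi)
    also have "\<dots> \<le> expectation (\<lambda>\<omega>. \<epsilon> / 2 + (Y k \<omega> - Z \<omega>)\<^sup>2 / (2 * \<epsilon>))"
      using int pw by (intro order_trans[OF integral_norm_bound] integral_mono integrable_norm) (auto simp: cosi)
    also have "\<dots> = \<epsilon> / 2 + expectation (\<lambda>x. (Y k x - Z x)\<^sup>2) / (2 * \<epsilon>)"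
      using int by (simp add: prob_space)
    also have "\<dots> < e"
    proof -
      have "expectation (\<lambda>x. (Y k x - Z x)\<^sup>2) / (2 * \<epsilon>) < \<epsilon> / 2"
        using divide_strict_right_mono[OF small, of "2 * \<epsilon>"] \<epsilon> by simp
      moreover have "e = \<epsilon> + \<epsilon>" by (simp add: \<epsilon>_def)
      ultimately show ?thesis using \<epsilon> by linarith
    qed
    finally show ?thesis .
  qed
  then show "\<exists>n. \<forall>k\<ge>n. norm (expectation (\<lambda>\<omega>. cos (Y k \<omega>)) - expectation (\<lambda>\<omega>. cos (Z \<omega>))) < e"
    by blast
qed

text \<open>The closure of the elementary pairs in \<open>L\<^sup>2 \<times> L\<^sup>2\<close>. The integrals over different intervals
  \<open>[0, t]\<close> all become integrals over the whole line, of \<open>\<sigma>\<close> cut off at \<open>t\<close>, so that linear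
  combinations of them make sense.\<close>

definition wiener_integral ::
  "'a measure \<Rightarrow> (real \<Rightarrow> 'a \<Rightarrow> real) \<Rightarrow> (real \<Rightarrow> real) \<Rightarrow> ('a \<Rightarrow> real) \<Rightarrow> bool" where
  "wiener_integral M B h Z \<longleftrightarrow>
     Z \<in> borel_measurable M \<and> h \<in> borel_measurable lborel \<and> integrable lborel (\<lambda>s. (h s)\<^sup>2) \<and>
     (\<exists>hs Zs. (\<forall>k::nat. elementary_pair B (hs k) (Zs k)) \<and>
       (\<lambda>k. \<integral>\<^sup>+s. ennreal ((hs k s - h s)\<^sup>2) \<partial>lborel) \<longlonglongrightarrow> 0 \<and>
       (\<lambda>k. \<integral>\<^sup>+\<omega>. ennreal ((Zs k \<omega> - Z \<omega>)\<^sup>2) \<partial>M) \<longlonglongrightarrow> 0)"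

lemma (in prob_space) wiener_integral_linear:
  assumes bm: "standard_brownian_motion M B"
    and "wiener_integral M B h Z" "wiener_integral M B h' Z'"
  shows "wiener_integral M B (\<lambda>s. a * h s + b * h' s) (\<lambda>\<omega>. a * Z \<omega> + b * Z' \<omega>)"
proof -
  obtain hs Zs where 1: "\<And>k::nat. elementary_pair B (hs k) (Zs k)"
       "(\<lambda>k. \<integral>\<^sup>+s. ennreal ((hs k s - h s)\<^sup>2) \<partial>lborel) \<longlonglongrightarrow> 0"
       "(\<lambda>k. \<integral>\<^sup>+\<omega>. ennreal ((Zs k \<omega> - Z \<omega>)\<^sup>2) \<partial>M) \<longlonglongrightarrow> 0"
    and [measurable]: "Z \<in> borel_measurable M" "h \<in> borel_measurable lborel"
    and int: "integrable lborel (\<lambda>s. (h s)\<^sup>2)"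
    using assms(2) unfolding wiener_integral_def by auto
  obtain hs' Zs' where 2: "\<And>k::nat. elementary_pair B (hs' k) (Zs' k)"
       "(\<lambda>k. \<integral>\<^sup>+s. ennreal ((hs' k s - h' s)\<^sup>2) \<partial>lborel) \<longlonglongrightarrow> 0"
       "(\<lambda>k. \<integral>\<^sup>+\<omega>. ennreal ((Zs' k \<omega> - Z' \<omega>)\<^sup>2) \<partial>M) \<longlonglongrightarrow> 0"
    and [measurable]: "Z' \<in> borel_measurable M" "h' \<in> borel_measurable lborel"
    and int': "integrable lborel (\<lambda>s. (h' s)\<^sup>2)"
    using assms(3) unfolding wiener_integral_def by auto
  note [measurable] = elementary_pair_gaussian(1,3)[OF bm 1(1)] elementary_pair_gaussian(1,3)[OF bm 2(1)]
  have "integrable lborel (\<lambda>s. (a * h s + b * h' s)\<^sup>2)"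
  proof (rule Bochner_Integration.integrable_bound)
    show "integrable lborel (\<lambda>s. 2 * a\<^sup>2 * (h s)\<^sup>2 + 2 * b\<^sup>2 * (h' s)\<^sup>2)"
      using int int' by auto
    have "(a * h s + b * h' s)\<^sup>2 \<le> 2 * a\<^sup>2 * (h s)\<^sup>2 + 2 * b\<^sup>2 * (h' s)\<^sup>2" for s
      using sum_squares_bound[of "a * h s" "b * h' s"] by (simp add: power2_sum power_mult_distrib)
    then show "AE s in lborel. norm ((a * h s + b * h' s)\<^sup>2) \<le> norm (2 * a\<^sup>2 * (h s)\<^sup>2 + 2 * b\<^sup>2 * (h' s)\<^sup>2)"
      by auto
  qed simp
  moreover have "elementary_pair B (\<lambda>s. a * hs k s + b * hs' k s) (\<lambda>\<omega>. a * Zs k \<omega> + b * Zs' k \<omega>)" for k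
    by (intro elementary_pair_add elementary_pair_scale 1 2)
  moreover have "(\<lambda>k. \<integral>\<^sup>+s. ennreal ((a * hs k s + b * hs' k s - (a * h s + b * h' s))\<^sup>2) \<partial>lborel) \<longlonglongrightarrow> 0"
    using tendsto_nn_integral_square_combine[OF _ _ 1(2) 2(2), of a b] by (simp add: algebra_simps)
  moreover have "(\<lambda>k. \<integral>\<^sup>+\<omega>. ennreal ((a * Zs k \<omega> + b * Zs' k \<omega> - (a * Z \<omega> + b * Z' \<omega>))\<^sup>2) \<partial>M) \<longlonglongrightarrow> 0"
    using tendsto_nn_integral_square_combine[OF _ _ 1(3) 2(3), of a b] by (simp add: algebra_simps)
  ultimately show ?thesis
    unfolding wiener_integral_def
    by (intro conjI exI[of _ "\<lambda>k s. a * hs k s + b * hs' k s"] exI[of _ "\<lambda>k \<omega>. a * Zs k \<omega> + b * Zs' k \<omega>"]) auto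
qed

lemma (in prob_space) wiener_integral_gaussian:
  assumes bm: "standard_brownian_motion M B" and "wiener_integral M B h Z"
  shows "expectation (\<lambda>\<omega>. cos (Z \<omega>)) = exp (- (LINT s|lborel. (h s)\<^sup>2) / 2)"
proof -
  obtain hs Zs where 1: "\<And>k::nat. elementary_pair B (hs k) (Zs k)"
       "(\<lambda>k. \<integral>\<^sup>+s. ennreal ((hs k s - h s)\<^sup>2) \<partial>lborel) \<longlonglongrightarrow> 0"
       "(\<lambda>k. \<integral>\<^sup>+\<omega>. ennreal ((Zs k \<omega> - Z \<omega>)\<^sup>2) \<partial>M) \<longlonglongrightarrow> 0"
    and [measurable]: "Z \<in> borel_measurable M" "h \<in> borel_measurable lborel"
    and int: "integrable lborel (\<lambda>s. (h s)\<^sup>2)"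
    using assms(2) unfolding wiener_integral_def by auto
  note el = elementary_pair_gaussian[OF bm 1(1)]
  have "(\<lambda>k. LINT s|lborel. (hs k s)\<^sup>2) \<longlonglongrightarrow> (LINT s|lborel. (h s)\<^sup>2)"
    using el int by (intro tendsto_integral_square_of_L2 1(2)) auto
  then have "(\<lambda>k. exp (- (LINT s|lborel. (hs k s)\<^sup>2) / 2)) \<longlonglongrightarrow> exp (- (LINT s|lborel. (h s)\<^sup>2) / 2)"
    by (intro tendsto_intros) auto
  moreover have "(\<lambda>k. expectation (\<lambda>\<omega>. cos (Zs k \<omega>))) \<longlonglongrightarrow> expectation (\<lambda>\<omega>. cos (Z \<omega>))"
    using el by (intro tendsto_expectation_cos_of_L2 1(3)) auto
  ultimately show ?thesis
    unfolding el(4) by (rule LIMSEQ_unique[symmetric])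
qed

lemma integrable_square_indicator:
  fixes \<sigma> :: "real \<Rightarrow> real"
  assumes "continuous_on {0..} \<sigma>"
  shows "integrable lborel (\<lambda>s. (\<sigma> s)\<^sup>2 * indicator {0..t} s)"
proof -
  have "set_integrable lborel {0..t} (\<lambda>s. (\<sigma> s)\<^sup>2)"
    using assms by (intro borel_integrable_atLeastAtMost' continuous_intros continuous_on_subset[OF assms]) auto
  then show ?thesis by (simp add: set_integrable_def mult.commute)
qed

text \<open>The approximating step functions live on \<open>[0, t]\<close>, hence approximate the cut-off integrand on
  the whole line just as well.\<close>

lemma is_ito_integral_imp_wiener_integral:
  assumes "is_ito_integral M B \<sigma> t Y" "continuous_on {0..} \<sigma>" "0 \<le> t"
  shows "wiener_integral M B (\<lambda>s. \<sigma> s * indicator {0..t} s) Y"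
proof -
  obtain n \<tau> c where \<tau>: "\<And>k. 0 \<le> \<tau> k 0 \<and> mono_on {..n k} (\<tau> k) \<and> \<tau> k (n k) \<le> t"
    and lim: "(\<lambda>k. \<integral>\<^sup>+s\<in>{0..t}. ennreal ((step_fun (n k) (\<tau> k) (c k) s - \<sigma> s)\<^sup>2) \<partial>lborel) \<longlonglongrightarrow> 0"
      "(\<lambda>k. \<integral>\<^sup>+\<omega>. ennreal ((step_integral B (n k) (\<tau> k) (c k) \<omega> - Y \<omega>)\<^sup>2) \<partial>M) \<longlonglongrightarrow> 0"
    and Y: "Y \<in> borel_measurable M"
    using assms(1) unfolding is_ito_integral_def by blast
  have "ennreal ((step_fun (n k) (\<tau> k) (c k) s - \<sigma> s)\<^sup>2) * indicator {0..t} s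
      = ennreal ((step_fun (n k) (\<tau> k) (c k) s - \<sigma> s * indicator {0..t} s)\<^sup>2)" for k s
  proof (cases "s \<in> {0..t}")
    case False
    then have "step_fun (n k) (\<tau> k) (c k) s = 0"
      using \<tau>[of k] by (intro step_fun_eq_0) auto
    then show ?thesis using False by simp
  qed simp
  then have "(\<lambda>k. \<integral>\<^sup>+s. ennreal ((step_fun (n k) (\<tau> k) (c k) s - \<sigma> s * indicator {0..t} s)\<^sup>2) \<partial>lborel)
      \<longlonglongrightarrow> 0"
    using lim(1) by simp
  moreover have "elementary_pair B (step_fun (n k) (\<tau> k) (c k)) (step_integral B (n k) (\<tau> k) (c k))" for k
    using \<tau>[of k] by (intro elementary_pair_step) auto
  moreover have "(\<lambda>s. \<sigma> s * indicator {0..t} s) \<in> borel_measurable lborel"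
    using borel_measurable_continuous_on_indicator[of "{0..t}" \<sigma>] continuous_on_subset[OF assms(2), of "{0..t}"]
    by (simp add: mult.commute)
  moreover have "integrable lborel (\<lambda>s. (\<sigma> s * indicator {0..t} s)\<^sup>2)"
    using integrable_square_indicator[OF assms(2), of t]
    by (rule back_subst[of "integrable lborel"]) (auto simp: indicator_def)
  ultimately show ?thesis using lim(2) Y unfolding wiener_integral_def
    by (intro conjI exI[of _ "\<lambda>k. step_fun (n k) (\<tau> k) (c k)"]
        exI[of _ "\<lambda>k. step_integral B (n k) (\<tau> k) (c k)"]) auto
qed

definition energy :: "(real \<Rightarrow> real) \<Rightarrow> real \<Rightarrow> real" where
  "energy \<sigma> t = (LINT s|lborel. (\<sigma> s)\<^sup>2 * indicator {0..t} s)"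

text \<open>Two consecutive increments are jointly Gaussian and uncorrelated, with variances given by the
  increments of \<open>energy\<close>. This is all that is used about stochastic integrals.\<close>

lemma (in prob_space) ito_increments_gaussian:
  assumes bm: "standard_brownian_motion M B" and \<sigma>: "continuous_on {0..} \<sigma>"
    and I: "\<And>t. 0 \<le> t \<Longrightarrow> is_ito_integral M B \<sigma> t (I t)"
    and order: "0 \<le> s" "s \<le> t" "t \<le> u"
  shows "expectation (\<lambda>\<omega>. cos (a * (I t \<omega> - I s \<omega>) + b * (I u \<omega> - I t \<omega>)))
    = exp (- (a\<^sup>2 * (energy \<sigma> t - energy \<sigma> s) + b\<^sup>2 * (energy \<sigma> u - energy \<sigma> t)) / 2)"
proof -
  let ?h = "\<lambda>t s. \<sigma> s * indicator {0..t} s"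
  have w: "wiener_integral M B (?h r) (I r)" if "0 \<le> r" for r
    using is_ito_integral_imp_wiener_integral[OF I[OF that] \<sigma> that] .
  have "wiener_integral M B (\<lambda>r. a * (1 * ?h t r + (- 1) * ?h s r) + b * (1 * ?h u r + (- 1) * ?h t r))
      (\<lambda>\<omega>. a * (1 * I t \<omega> + (- 1) * I s \<omega>) + b * (1 * I u \<omega> + (- 1) * I t \<omega>))"
    using order by (intro wiener_integral_linear bm w) auto
  from wiener_integral_gaussian[OF bm this]
  have "expectation (\<lambda>\<omega>. cos (a * (I t \<omega> - I s \<omega>) + b * (I u \<omega> - I t \<omega>)))
    = exp (- (LINT r|lborel. (a * (?h t r - ?h s r) + b * (?h u r - ?h t r))\<^sup>2) / 2)"
    by simp
  also have "(LINT r|lborel. (a * (?h t r - ?h s r) + b * (?h u r - ?h t r))\<^sup>2)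
      = (LINT r|lborel. a\<^sup>2 * ((\<sigma> r)\<^sup>2 * indicator {0..t} r - (\<sigma> r)\<^sup>2 * indicator {0..s} r)
          + b\<^sup>2 * ((\<sigma> r)\<^sup>2 * indicator {0..u} r - (\<sigma> r)\<^sup>2 * indicator {0..t} r))"
    using order by (intro Bochner_Integration.integral_cong) (auto simp: indicator_def power_mult_distrib)
  also have "\<dots> = a\<^sup>2 * (energy \<sigma> t - energy \<sigma> s) + b\<^sup>2 * (energy \<sigma> u - energy \<sigma> t)"
    using integrable_square_indicator[OF \<sigma>] by (simp add: energy_def)
  finally show ?thesis .
qed

section \<open>Regular variation at zero\<close>

text \<open>The uniform convergence theorem in additive form. Pointwise convergence puts every shift \<open>u\<close>
  into one of the closed sets \<open>E n\<close> of shifts for which the difference is small from \<open>n\<close> onwards.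
  By Baire's theorem some \<open>E n\<close> contains an interval around a shift \<open>a\<close>, and comparing the shifts
  \<open>a\<close> and \<open>a + u\<close> from the same base point gives uniformity for \<open>u\<close> near 0.\<close>

lemma slowly_varying_locally_uniform:
  fixes k :: "real \<Rightarrow> real"
  assumes cont: "continuous_on UNIV k"
    and lim: "\<And>u. ((\<lambda>x. k (x + u) - k x) \<longlongrightarrow> 0) at_top"
  shows "((\<lambda>(x, u). k (x + u) - k x) \<longlongrightarrow> 0) (at_top \<times>\<^sub>F nhds 0)"
proof (rule tendstoI)
  fix e :: real assume e: "0 < e"
  define E where "E n = {u. \<forall>x\<ge>real n. \<bar>k (x + u) - k x\<bar> \<le> e / 3}" for n
  have closed: "closed (E n)" for n
  proof -
    have "E n = (\<Inter>x\<in>{real n..}. {u. \<bar>k (x + u) - k x\<bar> \<le> e / 3})"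
      by (auto simp: E_def)
    moreover have "closed {u. \<bar>k (x + u) - k x\<bar> \<le> e / 3}" for x
      by (intro closed_Collect_le continuous_intros continuous_on_compose2[OF cont]) auto
    ultimately show ?thesis by (auto intro!: closed_INT)
  qed
  have cover: "\<exists>n. u \<in> E n" for u
  proof -
    have "eventually (\<lambda>x. \<bar>k (x + u) - k x\<bar> < e / 3) at_top"
      using tendstoD[OF lim[of u], of "e / 3"] e by (simp add: dist_real_def)
    then obtain A where A: "\<And>x. A \<le> x \<Longrightarrow> \<bar>k (x + u) - k x\<bar> < e / 3"
      by (auto simp: eventually_at_top_linorder)
    obtain n where "A \<le> real n" using real_arch_simple by blast
    then have "u \<in> E n" using A unfolding E_def by (auto intro: less_imp_le)
    then show ?thesis ..
  qed
  have "\<exists>n. interior (E n) \<noteq> {}"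
  proof (rule ccontr)
    assume "\<not> ?thesis"
    then have "closure (- E n) = UNIV" for n by (simp add: closure_complement)
    then have "UNIV \<subseteq> closure (\<Inter>(range (\<lambda>n. - E n)))"
      using closed by (intro Baire) (auto simp: open_Compl)
    moreover have "\<Inter>(range (\<lambda>n. - E n)) = {}" using cover by auto
    ultimately show False by (metis UNIV_not_empty closure_empty subset_empty)
  qed
  then obtain n a where "a \<in> interior (E n)" by blast
  then obtain d where d: "d > 0" "ball a d \<subseteq> E n" by (meson mem_interior)
  have "dist (k (y + u) - k y) 0 < e" if "real n + a \<le> y" "\<bar>u\<bar> < d" for y u
  proof -
    have *: "\<bar>k ((y - a) + v) - k (y - a)\<bar> \<le> e / 3" if "v \<in> ball a d" for v
      using d(2) that \<open>real n + a \<le> y\<close> unfolding E_def by auto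
    have "a + u \<in> ball a d" "a \<in> ball a d" using that(2) d(1) by (auto simp: dist_real_def)
    from this[THEN *] have "\<bar>k (y + u) - k (y - a)\<bar> \<le> e / 3" "\<bar>k y - k (y - a)\<bar> \<le> e / 3"
      by simp_all
    then have "\<bar>k (y + u) - k y\<bar> < e" using e by linarith
    then show ?thesis by (simp add: dist_real_def)
  qed
  moreover have "eventually (\<lambda>y. real n + a \<le> y) at_top" by (rule eventually_ge_at_top)
  moreover have "eventually (\<lambda>u. \<bar>u\<bar> < d) (nhds (0::real))"
    using d(1) by (auto simp: eventually_nhds_metric dist_real_def)
  ultimately show "\<forall>\<^sub>F p in at_top \<times>\<^sub>F nhds 0. dist (case p of (x, u) \<Rightarrow> k (x + u) - k x) 0 < e"
    unfolding eventually_prod_filter by fast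
qed

text \<open>The limit of \<open>f (c x) / f x\<close> at \<open>0+\<close> when \<open>f\<close> is also asymptotically odd. Its fixed points
  are the possible limits of \<open>X / F\<^sup>-\<^sup>1\<close>.\<close>

definition signed_powr :: "real \<Rightarrow> real \<Rightarrow> real" where
  "signed_powr c \<beta> = sgn c * \<bar>c\<bar> powr \<beta>"

lemma signed_powr_eq_self_iff:
  assumes "\<beta> \<noteq> 1"
  shows "signed_powr c \<beta> = c \<longleftrightarrow> c \<in> {-1, 0, 1}"
proof (cases "c = 0")
  case False
  have "signed_powr c \<beta> = c \<longleftrightarrow> \<bar>c\<bar> powr \<beta> = \<bar>c\<bar>"
    using False by (cases "c > 0") (auto simp: signed_powr_def sgn_if)
  also have "\<dots> \<longleftrightarrow> \<bar>c\<bar> powr (\<beta> - 1) = 1"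
    using False by (auto simp: powr_diff field_simps)
  also have "\<dots> \<longleftrightarrow> \<bar>c\<bar> = 1"
    using False assms by (auto simp: powr_def)
  finally show ?thesis using False by auto
qed (simp add: signed_powr_def)

lemma filterlim_prod_map:
  assumes "filterlim u F' F" "filterlim v G' G"
  shows "filterlim (\<lambda>p. (u (fst p), v (snd p))) (F' \<times>\<^sub>F G') (F \<times>\<^sub>F G)"
  by (intro filterlim_Pair filterlim_compose[OF assms(1)] filterlim_compose[OF assms(2)]
      filterlim_fst filterlim_snd)

lemma filterlim_mult_at_right_0:
  assumes "0 < c"
  shows "filterlim (\<lambda>x::real. c * x) (at_right 0) (at_right 0)"
  using assms by (intro filterlim_at_withinI tendsto_eq_intros eventually_at_rightI[of 0 1]) auto

locale regularly_varying =
  fixes f :: "real \<Rightarrow> real" and \<beta> :: real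
  assumes cont: "continuous_on {0<..} f"
    and pos: "\<And>x. 0 < x \<Longrightarrow> 0 < f x"
    and lim: "\<And>c. 0 < c \<Longrightarrow> ((\<lambda>x. f (c * x) / f x) \<longlongrightarrow> c powr \<beta>) (at_right 0)"
begin

text \<open>Uniform convergence for the function \<open>ln (f (exp (- y))) + \<beta> y\<close> of \<open>y\<close>, in which multiplying the argument of
  \<open>f\<close> by \<open>c\<close> becomes a shift by \<open>- ln c\<close>.\<close>

lemma ratio_tendsto_1:
  "((\<lambda>(x, c). f (c * x) / f x) \<longlongrightarrow> 1) (at_right 0 \<times>\<^sub>F nhds 1)"
proof -
  define k where "k y = ln (f (exp (- y))) + \<beta> * y" for y
  have "continuous_on UNIV k"
    unfolding k_def using pos
    by (intro continuous_intros continuous_on_compose2[OF cont]) (auto simp: less_imp_neq[THEN not_sym])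
  moreover have "((\<lambda>y. k (y + u) - k y) \<longlongrightarrow> 0) at_top" for u
  proof -
    have inf: "filterlim (\<lambda>y::real. exp (- y)) (at_right 0) at_top"
      by (intro filterlim_at_withinI always_eventually)
        (auto intro: filterlim_compose[OF exp_at_bot filterlim_uminus_at_bot_at_top])
    have "((\<lambda>y. f (exp (- u) * exp (- y)) / f (exp (- y))) \<longlongrightarrow> exp (- u) powr \<beta>) at_top"
      using filterlim_compose[OF lim[of "exp (- u)"] inf] by simp
    then have "((\<lambda>y. ln (f (exp (- u) * exp (- y)) / f (exp (- y))) + \<beta> * u)
        \<longlongrightarrow> ln (exp (- u) powr \<beta>) + \<beta> * u) at_top"
      by (intro tendsto_intros) auto
    moreover have "ln (f (exp (- u) * exp (- y)) / f (exp (- y))) + \<beta> * u = k (y + u) - k y" for y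
    proof -
      have "exp (- (y + u)) = exp (- u) * exp (- y)" by (simp flip: exp_add)
      then show ?thesis
        using pos[of "exp (- y)"] pos[of "exp (- u) * exp (- y)"]
        unfolding k_def by (simp add: ln_div algebra_simps del: mult_exp_exp)
    qed
    ultimately show ?thesis by (simp add: powr_def)
  qed
  ultimately have *: "((\<lambda>(x, u). k (x + u) - k x) \<longlongrightarrow> 0) (at_top \<times>\<^sub>F nhds 0)"
    by (rule slowly_varying_locally_uniform)
  have "filterlim (\<lambda>x::real. - ln x) at_top (at_right 0)"
    by (rule filterlim_compose[OF filterlim_uminus_at_top_at_bot ln_at_0])
  moreover have ln1: "((\<lambda>c::real. - ln c) \<longlongrightarrow> 0) (nhds 1)"
    by (auto intro!: tendsto_eq_intros filterlim_ident)
  ultimately have "filterlim (\<lambda>p. (- ln (fst p), - ln (snd p))) (at_top \<times>\<^sub>F nhds 0)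
      (at_right (0::real) \<times>\<^sub>F nhds (1::real))"
    by (rule filterlim_prod_map)
  from filterlim_compose[OF * this]
  have k0: "((\<lambda>p. k (- ln (fst p) + - ln (snd p)) - k (- ln (fst p))) \<longlongrightarrow> 0)
      (at_right 0 \<times>\<^sub>F nhds 1)" by (simp only: prod.case)
  have "((\<lambda>p. - ln (snd p)) \<longlongrightarrow> 0) (at_right (0::real) \<times>\<^sub>F nhds (1::real))"
    by (rule filterlim_compose[OF ln1 filterlim_snd])
  then have "((\<lambda>p. exp (k (- ln (fst p) + - ln (snd p)) - k (- ln (fst p)) - \<beta> * (- ln (snd p))))
      \<longlongrightarrow> exp (0 - \<beta> * 0)) (at_right 0 \<times>\<^sub>F nhds 1)"
    by (intro tendsto_intros k0)
  moreover have "eventually (\<lambda>p. fst p > 0 \<and> snd p > 0) (at_right (0::real) \<times>\<^sub>F nhds (1::real))"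
    by (intro eventually_prodI[where P="\<lambda>x. x > 0" and Q="\<lambda>x. x > 0", simplified] eventually_conj)
      (auto simp: eventually_at_right_less eventually_nhds intro!: exI[of _ "{0<..}"])
  then have "eventually (\<lambda>p. exp (k (- ln (fst p) + - ln (snd p)) - k (- ln (fst p)) - \<beta> * (- ln (snd p)))
      = f (snd p * fst p) / f (fst p)) (at_right 0 \<times>\<^sub>F nhds 1)"
  proof (rule eventually_mono)
    fix p :: "real \<times> real" assume p: "fst p > 0 \<and> snd p > 0"
    have "k (- ln (fst p) + - ln (snd p)) - k (- ln (fst p)) - \<beta> * (- ln (snd p))
        = ln (f (snd p * fst p)) - ln (f (fst p))"
      using p by (simp add: k_def exp_add algebra_simps)
    then show "exp (k (- ln (fst p) + - ln (snd p)) - k (- ln (fst p)) - \<beta> * (- ln (snd p)))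
      = f (snd p * fst p) / f (fst p)"
      using p pos by (simp add: exp_diff)
  qed
  ultimately have "((\<lambda>p. f (snd p * fst p) / f (fst p)) \<longlongrightarrow> exp (0 - \<beta> * 0)) (at_right 0 \<times>\<^sub>F nhds 1)"
    by (rule Lim_transform_eventually)
  then show ?thesis by (simp add: case_prod_unfold)
qed

lemma ratio_tendsto_pos:
  assumes c: "0 < c"
  shows "((\<lambda>(x, y). f (y * x) / f x) \<longlongrightarrow> c powr \<beta>) (at_right 0 \<times>\<^sub>F nhds c)"
proof -
  have "((\<lambda>y. y / c) \<longlongrightarrow> 1) (nhds c)"
    using c by (auto intro!: tendsto_eq_intros filterlim_ident)
  from filterlim_prod_map[OF filterlim_mult_at_right_0[OF c] this]
  have "filterlim (\<lambda>p. (c * fst p, snd p / c)) (at_right 0 \<times>\<^sub>F nhds 1) (at_right 0 \<times>\<^sub>F nhds c)" .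
  from filterlim_compose[OF ratio_tendsto_1 this]
  have "((\<lambda>p. f (snd p / c * (c * fst p)) / f (c * fst p)) \<longlongrightarrow> 1) (at_right 0 \<times>\<^sub>F nhds c)"
    by simp
  moreover have "((\<lambda>p. f (c * fst p) / f (fst p)) \<longlongrightarrow> c powr \<beta>) (at_right 0 \<times>\<^sub>F nhds c)"
    by (rule filterlim_compose[OF lim[OF c] filterlim_fst])
  ultimately have "((\<lambda>p. f (snd p / c * (c * fst p)) / f (c * fst p) * (f (c * fst p) / f (fst p)))
      \<longlongrightarrow> 1 * c powr \<beta>) (at_right 0 \<times>\<^sub>F nhds c)"
    by (rule tendsto_mult)
  moreover have "eventually (\<lambda>p. f (snd p / c * (c * fst p)) / f (c * fst p) * (f (c * fst p) / f (fst p))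
      = f (snd p * fst p) / f (fst p)) (at_right 0 \<times>\<^sub>F nhds c)"
  proof -
    have "eventually (\<lambda>p. 0 < fst p) (at_right (0::real) \<times>\<^sub>F nhds c)"
      using eventually_at_right_less filterlim_fst[unfolded filterlim_iff] by blast
    then show ?thesis
    proof (rule eventually_mono)
      fix p :: "real \<times> real" assume "0 < fst p"
      then show "f (snd p / c * (c * fst p)) / f (c * fst p) * (f (c * fst p) / f (fst p))
          = f (snd p * fst p) / f (fst p)"
        using c pos[of "c * fst p"] by simp
    qed
  qed
  ultimately have "((\<lambda>p. f (snd p * fst p) / f (fst p)) \<longlongrightarrow> 1 * c powr \<beta>) (at_right 0 \<times>\<^sub>F nhds c)"
    by (rule Lim_transform_eventually)
  then show ?thesis by (simp add: case_prod_unfold)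
qed

text \<open>One of Potter's bounds. For a fixed \<open>q < 1\<close> close to 1 the ratio \<open>f (q x) / f x\<close> is close to
  \<open>q powr \<beta>\<close> and so below \<open>q powr \<alpha>\<close>; iterating this down the geometric grid of powers of \<open>q\<close>
  loses nothing, and local uniformity near 1 bridges the gap between neighbouring grid points.\<close>

lemma potter_bound:
  assumes \<alpha>: "0 \<le> \<alpha>" "\<alpha> < \<beta>"
  obtains C r where "0 < C" "0 < r"
    "\<And>x l. 0 < x \<Longrightarrow> x < r \<Longrightarrow> 0 < l \<Longrightarrow> l \<le> 1 \<Longrightarrow> f (l * x) \<le> C * l powr \<alpha> * f x"
proof -
  have "eventually (\<lambda>p. f (snd p * fst p) / f (fst p) < 2) (at_right 0 \<times>\<^sub>F nhds 1)"
    using order_tendstoD(2)[OF ratio_tendsto_1, of 2] by (simp add: case_prod_unfold)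
  then obtain P Q where PQ: "eventually P (at_right 0)" "eventually Q (nhds (1::real))"
    "\<And>x y. P x \<Longrightarrow> Q y \<Longrightarrow> f (y * x) / f x < 2"
    by (auto simp: eventually_prod_filter)
  obtain d where d: "d > 0" "\<And>y. \<bar>y - 1\<bar> < d \<Longrightarrow> Q y"
    using PQ(2) by (auto simp: eventually_nhds_metric dist_real_def)
  \<comment> \<open>\<open>q\<close> is taken so close to 1 that local uniformity covers the whole range \<open>(q, 1]\<close>\<close>
  define q where "q = max (1 / 2) (1 - d / 2)"
  have q: "0 < q" "q < 1" "1 - d < q" using d(1) by (auto simp: q_def)
  have "q powr \<beta> < q powr \<alpha>" using q \<alpha> by (simp add: powr_less_mono')
  then have "eventually (\<lambda>x. f (q * x) / f x < q powr \<alpha>) (at_right 0)"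
    by (rule order_tendstoD(2)[OF lim[OF q(1)]])
  with PQ(1) have "eventually (\<lambda>x. P x \<and> f (q * x) / f x < q powr \<alpha>) (at_right 0)"
    by (rule eventually_conj)
  then obtain r where r: "r > 0" "\<And>x. 0 < x \<Longrightarrow> x < r \<Longrightarrow> P x \<and> f (q * x) / f x < q powr \<alpha>"
    by (auto simp: eventually_at_right_field)
  have step: "f (q * x) \<le> q powr \<alpha> * f x" if "0 < x" "x < r" for x
    using r(2)[OF that] pos[OF that(1)] by (simp add: divide_simps)
  have top: "f (l * x) \<le> 2 * f x" if "0 < x" "x < r" "q < l" "l \<le> 1" for x l
    using PQ(3)[of x l] r(2)[OF that(1,2)] d(2)[of l] q that pos[OF that(1)]
    by (simp add: divide_simps)
  define C where "C = 2 / q powr \<alpha>"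
  have C: "C > 0" using q by (simp add: C_def)
  have "f (l * x) \<le> C * l powr \<alpha> * f x" if x: "0 < x" "x < r" and l: "q ^ n < l" "l \<le> 1" for n x l
    using l
  proof (induction n arbitrary: l)
    case (Suc n)
    have l0: "0 < l" using Suc.prems(1) q(1) by (meson less_trans zero_less_power)
    show ?case
    proof (cases "q < l")
      case True
      then have "q powr \<alpha> \<le> l powr \<alpha>" using q \<alpha> by (intro powr_mono2) auto
      then have "2 \<le> C * l powr \<alpha>" using q by (simp add: C_def divide_simps)
      then have "2 * f x \<le> C * l powr \<alpha> * f x"
        using pos[OF x(1)] by (intro mult_right_mono) auto
      then show ?thesis using top[OF x True Suc.prems(2)] by linarith
    next
      case False
      have l': "q ^ n < l / q" "l / q \<le> 1" "0 < l / q"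
        using False Suc.prems q l0 by (auto simp: field_simps)
      have "l / q * x \<le> x" using l'(2) x(1) by (metis mult_left_le_one_le mult.commute l'(3) less_imp_le)
      then have "f (q * (l / q * x)) \<le> q powr \<alpha> * f (l / q * x)"
        using x l'(3) by (intro step mult_pos_pos) auto
      also have "\<dots> \<le> q powr \<alpha> * (C * (l / q) powr \<alpha> * f x)"
        using Suc.IH[OF l'(1,2)] by (intro mult_left_mono) auto
      also have "\<dots> = C * l powr \<alpha> * f x"
        using q l0 by (simp add: powr_divide)
      finally show ?thesis using q by simp
    qed
  qed auto
  then have "f (l * x) \<le> C * l powr \<alpha> * f x" if "0 < x" "x < r" "0 < l" "l \<le> 1" for x l
    using real_arch_pow_inv[OF that(3) q(2)] that by blast
  then show thesis using that C r(1) by blast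
qed

end

locale odd_regularly_varying = regularly_varying +
  assumes index: "1 < \<beta>"
    and zero: "f 0 = 0"
    and odd: "((\<lambda>x. f (- x) / f x) \<longlongrightarrow> -1) (at_right 0)"
begin

text \<open>At \<open>c = 0\<close> local uniformity is no longer a matter of rescaling; Potter's bound with exponent
  \<open>1 < \<beta>\<close> dominates the ratio by a multiple of \<open>\<bar>y\<bar>\<close>.\<close>

lemma ratio_tendsto_0:
  "((\<lambda>(x, y). f (y * x) / f x) \<longlongrightarrow> 0) (at_right 0 \<times>\<^sub>F nhds 0)"
proof -
  obtain C r where C: "0 < C" "0 < r"
    "\<And>x l. 0 < x \<Longrightarrow> x < r \<Longrightarrow> 0 < l \<Longrightarrow> l \<le> 1 \<Longrightarrow> f (l * x) \<le> C * l powr 1 * f x"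
    using potter_bound[of 1] index by auto
  have "eventually (\<lambda>x. - 2 < f (- x) / f x \<and> f (- x) / f x < 0) (at_right 0)"
    using order_tendstoD[OF odd] by (intro eventually_conj) auto
  then obtain r' where r': "r' > 0" "\<And>x. 0 < x \<Longrightarrow> x < r' \<Longrightarrow> - 2 < f (- x) / f x \<and> f (- x) / f x < 0"
    by (auto simp: eventually_at_right_field)
  have bound: "norm (f (y * x) / f x) \<le> 2 * C * \<bar>y\<bar>"
    if x: "0 < x" "x < min r r'" and y: "\<bar>y\<bar> < 1" for x y
  proof (cases "y = 0")
    case False
    have 1: "f (\<bar>y\<bar> * x) \<le> C * \<bar>y\<bar> * f x" using C(3)[of x "\<bar>y\<bar>"] x y False by simp
    have p: "0 < f (\<bar>y\<bar> * x)" "0 < f x" using pos x False by auto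
    have "\<bar>y\<bar> * x \<le> 1 * x" using y x by (intro mult_right_mono) auto
    then have "\<bar>y\<bar> * x < r'" using x(2) by linarith
    then have "- 2 < f (- (\<bar>y\<bar> * x)) / f (\<bar>y\<bar> * x) \<and> f (- (\<bar>y\<bar> * x)) / f (\<bar>y\<bar> * x) < 0"
      using False x by (intro r'(2)) auto
    then have 2: "\<bar>f (- (\<bar>y\<bar> * x))\<bar> \<le> 2 * f (\<bar>y\<bar> * x)"
      using p(1) by (auto simp: field_simps split: abs_split)
    have "\<bar>f (y * x)\<bar> \<le> 2 * f (\<bar>y\<bar> * x)"
      using 2 p(1) by (cases "y > 0") auto
    then have "\<bar>f (y * x)\<bar> \<le> 2 * C * \<bar>y\<bar> * f x" using 1 by simp
    then show ?thesis using p(2) by (simp add: divide_simps abs_mult)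
  qed (simp add: zero)
  have "eventually (\<lambda>p. norm (case p of (x, y) \<Rightarrow> f (y * x) / f x) \<le> 2 * C * \<bar>snd p\<bar>)
      (at_right 0 \<times>\<^sub>F nhds 0)"
    unfolding eventually_prod_filter
  proof (intro exI conjI allI impI)
    show "eventually (\<lambda>x. 0 < x \<and> x < min r r') (at_right 0)"
      using C(2) r'(1) by (auto simp: eventually_at_right_field intro!: exI[of _ "min r r'"])
    show "eventually (\<lambda>y::real. \<bar>y\<bar> < 1) (nhds 0)"
      by (auto simp: eventually_nhds_metric dist_real_def intro!: exI[of _ 1])
  qed (use bound in auto)
  moreover have "((\<lambda>p. 2 * C * \<bar>snd p\<bar>) \<longlongrightarrow> 2 * C * \<bar>0\<bar>) (at_right (0::real) \<times>\<^sub>F nhds (0::real))"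
    by (intro tendsto_mult tendsto_const tendsto_rabs filterlim_snd)
  then have "((\<lambda>p. 2 * C * \<bar>snd p\<bar>) \<longlongrightarrow> 0) (at_right (0::real) \<times>\<^sub>F nhds (0::real))"
    by simp
  ultimately show ?thesis by (rule Lim_null_comparison)
qed

lemma ratio_tendsto_neg:
  assumes c: "c < 0"
  shows "((\<lambda>(x, y). f (y * x) / f x) \<longlongrightarrow> - ((- c) powr \<beta>)) (at_right 0 \<times>\<^sub>F nhds c)"
proof -
  let ?F = "at_right (0::real) \<times>\<^sub>F nhds c"
  have neg: "eventually (\<lambda>p. 0 < fst p \<and> snd p < 0) ?F"
    unfolding eventually_prod_filter
  proof (intro exI conjI allI impI)
    show "eventually (\<lambda>x. 0 < x) (at_right (0::real))" by (rule eventually_at_right_less)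
    show "eventually (\<lambda>y. y < 0) (nhds c)"
      using c by (auto simp: eventually_nhds intro!: exI[of _ "{..<0}"])
  qed auto
  have "filterlim (\<lambda>p. (fst p, - snd p)) (at_right 0 \<times>\<^sub>F nhds (- c)) ?F"
    by (rule filterlim_prod_map[OF filterlim_ident]) (intro tendsto_intros filterlim_ident)
  from filterlim_compose[OF ratio_tendsto_pos this] c
  have A: "((\<lambda>p. f (- snd p * fst p) / f (fst p)) \<longlongrightarrow> (- c) powr \<beta>) ?F" by simp
  have "((\<lambda>p. - snd p * fst p) \<longlongrightarrow> - c * 0) ?F"
    by (intro tendsto_mult tendsto_minus filterlim_snd filterlim_compose[OF _ filterlim_fst]
        tendsto_ident_at)
  then have "filterlim (\<lambda>p. - snd p * fst p) (at_right 0) ?F"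
    by (intro filterlim_at_withinI eventually_mono[OF neg]) (auto simp: mult_neg_pos)
  from filterlim_compose[OF odd this]
  have B: "((\<lambda>p. f (- (- snd p * fst p)) / f (- snd p * fst p)) \<longlongrightarrow> -1) ?F" .
  have "((\<lambda>p. f (- (- snd p * fst p)) / f (- snd p * fst p) * (f (- snd p * fst p) / f (fst p)))
     \<longlongrightarrow> -1 * (- c) powr \<beta>) ?F"
    by (rule tendsto_mult[OF B A])
  moreover have "eventually (\<lambda>p. f (- (- snd p * fst p)) / f (- snd p * fst p) *
      (f (- snd p * fst p) / f (fst p)) = (case p of (x, y) \<Rightarrow> f (y * x) / f x)) ?F"
    using neg
  proof (rule eventually_mono)
    fix p :: "real \<times> real" assume p: "0 < fst p \<and> snd p < 0"
    then have "0 < f (- snd p * fst p)" by (intro pos mult_pos_pos) auto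
    then show "f (- (- snd p * fst p)) / f (- snd p * fst p) *
      (f (- snd p * fst p) / f (fst p)) = (case p of (x, y) \<Rightarrow> f (y * x) / f x)"
      by (simp add: case_prod_unfold)
  qed
  ultimately show ?thesis by (simp add: Lim_transform_eventually)
qed

text \<open>Regular variation as a joint limit: the argument may be any \<open>y(t) x(t)\<close> with \<open>x \<rightarrow> 0+\<close> and
  \<open>y \<rightarrow> c\<close>. In this form it applies along trajectories.\<close>

lemma ratio_tendsto:
  "((\<lambda>(x, y). f (y * x) / f x) \<longlongrightarrow> signed_powr c \<beta>) (at_right 0 \<times>\<^sub>F nhds c)"
  using ratio_tendsto_pos[of c] ratio_tendsto_neg[of c] ratio_tendsto_0
  by (cases c "0::real" rule: linorder_cases) (auto simp: signed_powr_def)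

end

section \<open>Limits of scalar functions from their level crossings\<close>

lemma eventually_antimono_of_deriv_nonpos:
  fixes U :: "real \<Rightarrow> real"
  assumes "\<forall>\<^sub>F t in at_top. (U has_real_derivative U' t) (at t)"
    and "\<forall>\<^sub>F t in at_top. U' t \<le> 0"
  shows "\<exists>T. \<forall>t\<ge>T. \<forall>u\<ge>t. U u \<le> U t"
proof -
  from eventually_conj[OF assms] obtain T where T:
    "\<And>t. T \<le> t \<Longrightarrow> (U has_real_derivative U' t) (at t)" "\<And>t. T \<le> t \<Longrightarrow> U' t \<le> 0"
    by (auto simp: eventually_at_top_linorder)
  have "U u \<le> U t" if "T \<le> t" "t \<le> u" for t u
    using that T by (intro DERIV_nonpos_imp_nonincreasing[OF that(2)]) (meson order_trans)
  then show ?thesis by blast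
qed

lemma filterlim_at_top_of_deriv_ge:
  fixes u k :: "real \<Rightarrow> real"
  assumes u: "\<forall>\<^sub>F t in at_top. (u has_real_derivative u' t) (at t)"
    and k: "\<forall>\<^sub>F t in at_top. (k has_real_derivative k' t) (at t)"
    and le: "\<forall>\<^sub>F t in at_top. k' t \<le> u' t"
    and lim: "filterlim k at_top at_top"
  shows "filterlim u at_top at_top"
proof -
  have "\<exists>T. \<forall>t\<ge>T. \<forall>v\<ge>t. k v - u v \<le> k t - u t"
  proof (rule eventually_antimono_of_deriv_nonpos)
    show "\<forall>\<^sub>F t in at_top. ((\<lambda>t. k t - u t) has_real_derivative k' t - u' t) (at t)"
      using u k by eventually_elim (rule DERIV_diff)
    show "\<forall>\<^sub>F t in at_top. k' t - u' t \<le> 0" using le by eventually_elim simp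
  qed
  then obtain T where T: "\<And>t v. T \<le> t \<Longrightarrow> t \<le> v \<Longrightarrow> k v - u v \<le> k t - u t" by blast
  have "filterlim (\<lambda>t. - (k T - u T) + k t) at_top at_top"
    by (intro filterlim_tendsto_add_at_top[OF tendsto_const lim])
  moreover have "\<forall>\<^sub>F t in at_top. - (k T - u T) + k t \<le> u t"
    using eventually_ge_at_top[of T] by eventually_elim (use T[of T] in force)
  ultimately show ?thesis by (rule filterlim_at_top_mono)
qed

text \<open>If every late passage through the level \<open>c\<close> is upwards, a function that has once reached \<open>c\<close>
  stays above it: at the last time before a later value below \<open>c\<close> at which the level is reached,
  the function would have to be increasing.\<close>

lemma one_sided_of_crossing_upwards:
  fixes z :: "real \<Rightarrow> real"
  assumes deriv: "\<forall>\<^sub>F t in at_top. (z has_real_derivative z' t) (at t)"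
    and cross: "\<forall>\<^sub>F t in at_top. z t = c \<longrightarrow> 0 < z' t"
  shows "(\<forall>\<^sub>F t in at_top. c \<le> z t) \<or> (\<forall>\<^sub>F t in at_top. z t \<le> c)"
proof -
  from eventually_conj[OF deriv cross] obtain T where
    T: "\<And>t. T \<le> t \<Longrightarrow> (z has_real_derivative z' t) (at t)" "\<And>t. T \<le> t \<Longrightarrow> z t = c \<Longrightarrow> 0 < z' t"
    by (auto simp: eventually_at_top_linorder)
  show ?thesis
  proof (cases "\<exists>t\<ge>T. c \<le> z t")
    case True
    then obtain t0 where t0: "T \<le> t0" "c \<le> z t0" by blast
    have "c \<le> z t1" if "t0 \<le> t1" for t1
    proof (rule ccontr)
      assume neg: "\<not> c \<le> z t1"
      define A where "A = {t \<in> {t0..t1}. c \<le> z t}"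
      have contz: "continuous_on {t0..t1} z"
        using T(1) t0(1) by (intro continuous_at_imp_continuous_on ballI DERIV_isCont[of z "z' t" t for t]) auto
      have "A = {t0..t1} \<inter> z -` {c..}" by (auto simp: A_def)
      then have "closed A" using continuous_closed_preimage[OF contz, of "{c..}"] by simp
      moreover have A: "A \<noteq> {}" "bdd_above A" using t0 that by (auto simp: A_def)
      ultimately have SA: "Sup A \<in> A" using closed_contains_Sup by blast
      define t where "t = Sup A"
      have t: "t0 \<le> t" "t \<le> t1" "c \<le> z t" using SA by (auto simp: A_def t_def)
      have "t < t1" using t neg by (cases "t = t1") auto
      have after: "z v < c" if "t < v" "v \<le> t1" for v
      proof (rule ccontr)
        assume "\<not> z v < c"
        then have "v \<in> A" using that t by (auto simp: A_def)
        then have "v \<le> t" unfolding t_def by (rule cSup_upper[OF _ A(2)])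
        then show False using that by simp
      qed
      show False
      proof (cases "z t = c")
        case True
        obtain d where d: "d > 0" "\<And>h. 0 < h \<Longrightarrow> h < d \<Longrightarrow> z t < z (t + h)"
          using DERIV_pos_inc_right[OF T(1) T(2)[OF _ True]] t t0 by force
        define h where "h = min (d / 2) (t1 - t)"
        have "0 < h" "h < d" "t + h \<le> t1" using d(1) \<open>t < t1\<close> by (auto simp: h_def)
        then show False using d(2)[of h] after[of "t + h"] True by force
      next
        case False
        then have "c < z t" using t by simp
        moreover have "isCont z t" by (rule DERIV_isCont[OF T(1)]) (use t t0 in auto)
        ultimately have "\<forall>\<^sub>F v in at t. c < z v"
          by (auto simp: isCont_def intro: order_tendstoD)
        then have "\<forall>\<^sub>F v in at_right t. c < z v" by (auto simp: eventually_at_split)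
        then have "\<forall>\<^sub>F v in at_right t. c < z v \<and> v \<in> {t<..<t1}"
          using eventually_at_right_real[OF \<open>t < t1\<close>] by (rule eventually_conj)
        then have "\<exists>v. c < z v \<and> v \<in> {t<..<t1}"
          by (rule eventually_happens'[rotated]) simp
        then obtain v where "c < z v" "t < v" "v < t1" by auto
        then show False using after[of v] by simp
      qed
    qed
    then show ?thesis by (auto simp: eventually_at_top_linorder)
  next
    case False
    then have "\<forall>t\<ge>T. z t \<le> c" by auto
    then show ?thesis by (auto simp: eventually_at_top_linorder)
  qed
qed

lemma one_sided_of_crossing_downwards:
  fixes z :: "real \<Rightarrow> real"
  assumes deriv: "\<forall>\<^sub>F t in at_top. (z has_real_derivative z' t) (at t)"
    and cross: "\<forall>\<^sub>F t in at_top. z t = c \<longrightarrow> z' t < 0"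
  shows "(\<forall>\<^sub>F t in at_top. c \<le> z t) \<or> (\<forall>\<^sub>F t in at_top. z t \<le> c)"
proof -
  have "(\<forall>\<^sub>F t in at_top. - c \<le> - z t) \<or> (\<forall>\<^sub>F t in at_top. - z t \<le> - c)"
  proof (rule one_sided_of_crossing_upwards)
    show "\<forall>\<^sub>F t in at_top. ((\<lambda>t. - z t) has_real_derivative - z' t) (at t)"
      using deriv by eventually_elim (rule DERIV_minus)
    show "\<forall>\<^sub>F t in at_top. - z t = - c \<longrightarrow> 0 < - z' t" using cross by eventually_elim simp
  qed
  then show ?thesis by auto
qed

text \<open>A function that oscillates between two levels passes through all levels in between, in both
  directions and at arbitrarily late times; so no oscillation is possible if only finitely many
  levels are exempted.\<close>

lemma convergent_of_one_sided:
  fixes z :: "real \<Rightarrow> real"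
  assumes E: "finite E"
    and side: "\<And>c. c \<notin> E \<Longrightarrow> (\<forall>\<^sub>F t in at_top. c \<le> z t) \<or> (\<forall>\<^sub>F t in at_top. z t \<le> c)"
  shows "(\<exists>L. (z \<longlongrightarrow> L) at_top) \<or> filterlim z at_top at_top \<or> filterlim z at_bot at_top"
proof -
  let ?z = "\<lambda>t. ereal (z t)"
  have "Liminf at_top ?z = Limsup at_top ?z"
  proof (rule ccontr)
    assume "Liminf at_top ?z \<noteq> Limsup at_top ?z"
    then have "Liminf at_top ?z < Limsup at_top ?z"
      using Liminf_le_Limsup[of "at_top :: real filter" ?z] by simp
    then obtain a where a: "Liminf at_top ?z < ereal a" "ereal a < Limsup at_top ?z"
      using ereal_dense2 by blast
    then obtain b where b: "ereal a < ereal b" "ereal b < Limsup at_top ?z"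
      using ereal_dense2 by blast
    have "infinite ({a<..<b} - E)" using b(1) E by simp
    then obtain c where c: "a < c" "c < b" "c \<notin> E" by (metis DiffD1 DiffD2 finite.emptyI greaterThanLessThan_iff ex_in_conv)
    from side[OF c(3)] show False
    proof
      assume "\<forall>\<^sub>F t in at_top. c \<le> z t"
      then have "ereal c \<le> Liminf at_top ?z" by (intro Liminf_bounded) (simp add: eventually_mono)
      then show False using a(1) c(1) by (metis ereal_less_eq(3) less_imp_le not_less order_trans)
    next
      assume "\<forall>\<^sub>F t in at_top. z t \<le> c"
      then have "Limsup at_top ?z \<le> ereal c" by (intro Limsup_bounded) (simp add: eventually_mono)
      then show False using b(2) c(2) by (metis ereal_less_eq(3) less_imp_le not_less order_trans)
    qed
  qed
  then obtain l where l: "(?z \<longlongrightarrow> l) at_top"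
    using tendsto_iff_Liminf_eq_Limsup[of "at_top :: real filter" ?z] by auto
  then show ?thesis
    by (cases l) (auto simp: tendsto_PInfty_eq_at_top tendsto_MInfty filterlim_at_bot_dense)
qed

lemma convergent_of_antimono_bdd_below:
  fixes U :: "real \<Rightarrow> real"
  assumes "\<And>t u. T \<le> t \<Longrightarrow> t \<le> u \<Longrightarrow> U u \<le> U t" and "\<And>t. T \<le> t \<Longrightarrow> m \<le> U t"
  shows "\<exists>L. (U \<longlongrightarrow> L) at_top"
proof -
  have "(\<forall>\<^sub>F t in at_top. c \<le> U t) \<or> (\<forall>\<^sub>F t in at_top. U t \<le> c)" for c
  proof (cases "\<exists>t\<ge>T. U t \<le> c")
    case True
    then obtain t where t: "T \<le> t" "U t \<le> c" by blast
    then have "\<forall>u\<ge>t. U u \<le> c" using assms(1) order_trans by blast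
    then show ?thesis by (auto simp: eventually_at_top_linorder)
  next
    case False
    then have "\<forall>u\<ge>T. c \<le> U u" by auto
    then show ?thesis by (auto simp: eventually_at_top_linorder)
  qed
  then have "(\<exists>L. (U \<longlongrightarrow> L) at_top) \<or> filterlim U at_top at_top \<or> filterlim U at_bot at_top"
    by (intro convergent_of_one_sided[of "{}"]) auto
  moreover have "\<not> filterlim U at_top at_top"
  proof
    assume "filterlim U at_top at_top"
    then have "\<forall>\<^sub>F t in at_top. U T < U t" by (simp add: filterlim_at_top_dense)
    then have "\<forall>\<^sub>F t in at_top. U T < U t \<and> T \<le> t" using eventually_ge_at_top by (rule eventually_conj)
    then show False using assms(1)[of T] eventually_happens[of _ "at_top :: real filter"] by force
  qed
  moreover have "\<not> filterlim U at_bot at_top"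
  proof
    assume "filterlim U at_bot at_top"
    then have "\<forall>\<^sub>F t in at_top. U t < m" by (simp add: filterlim_at_bot_dense)
    then have "\<forall>\<^sub>F t in at_top. U t < m \<and> T \<le> t" using eventually_ge_at_top by (rule eventually_conj)
    then show False using assms(2) eventually_happens[of _ "at_top :: real filter"] by force
  qed
  ultimately show ?thesis by blast
qed

section \<open>The scale function\<close>

locale restoring_force = odd_regularly_varying +
  assumes continuous: "continuous_on UNIV f"
    and neg: "\<And>x. x < 0 \<Longrightarrow> f x < 0"
    and sublinear: "((\<lambda>x. f x / x) \<longlongrightarrow> 0) (at_right 0)"
begin

lemma scale_fun_deriv:
  assumes x: "0 < x"
  shows "(scale_fun f has_real_derivative - 1 / f x) (at x)"
proof -
  define a where "a = min (x / 2) (1 / 2)"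
  define b where "b = max (2 * x) 2"
  have ab: "0 < a" "a \<le> 1" "1 \<le> b" "a < x" "x < b" using x by (auto simp: a_def b_def)
  have "continuous_on {a..b} (\<lambda>u. 1 / f u)"
    using pos ab(1) by (intro continuous_intros continuous_on_subset[OF continuous])
      (auto simp: less_imp_neq[THEN not_sym])
  then have "((\<lambda>u. LBINT y=ereal 1..ereal u. 1 / f y) has_vector_derivative 1 / f x) (at x within {a..b})"
    using ab by (intro interval_integral_FTC2) auto
  then have "((\<lambda>u. LBINT y=ereal 1..ereal u. 1 / f y) has_real_derivative 1 / f x) (at x)"
    using ab by (simp add: has_real_derivative_iff_has_vector_derivative at_within_Icc_at)
  then have "((\<lambda>u. - (LBINT y=ereal 1..ereal u. 1 / f y)) has_real_derivative - (1 / f x)) (at x)"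
    by (rule DERIV_minus)
  moreover have "(\<lambda>u. - (LBINT y=ereal 1..ereal u. 1 / f y)) = scale_fun f"
    unfolding scale_fun_def by (subst interval_integral_endpoints_reverse) simp
  ultimately show ?thesis by simp
qed

lemma scale_fun_strict_antimono:
  assumes "0 < x" "x < y"
  shows "scale_fun f y < scale_fun f x"
  using assms(2)
proof (rule DERIV_neg_imp_decreasing)
  fix u assume "x \<le> u" "u \<le> y"
  then show "\<exists>d. (scale_fun f has_real_derivative d) (at u) \<and> d < 0"
    using scale_fun_deriv[of u] pos[of u] assms(1) by (intro exI[of _ "- 1 / f u"]) auto
qed

lemma scale_fun_inj: "inj_on (scale_fun f) {0<..}"
  using scale_fun_strict_antimono by (intro linorder_inj_onI) (auto simp: less_imp_neq[THEN not_sym])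

text \<open>The scale function is unbounded near 0 because \<open>f x \<le> x\<close> there, which makes
  \<open>scale_fun f x + ln x\<close> decreasing.\<close>

lemma scale_fun_onto:
  assumes "0 \<le> t"
  shows "\<exists>x>0. scale_fun f x = t"
proof -
  have "\<forall>\<^sub>F x in at_right 0. f x / x < 1" using order_tendstoD(2)[OF sublinear, of 1] by simp
  then obtain d where d: "d > 0" "\<And>x. 0 < x \<Longrightarrow> x < d \<Longrightarrow> f x / x < 1"
    by (auto simp: eventually_at_right_field)
  define y where "y = min (d / 2) (1 / 2)"
  have y: "0 < y" "y < d" "y < 1" using d(1) by (auto simp: y_def)
  have grow: "scale_fun f y + ln y \<le> scale_fun f x + ln x" if "0 < x" "x \<le> y" for x
    using that(2)
  proof (rule DERIV_nonpos_imp_nonincreasing)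
    fix u assume u: "x \<le> u" "u \<le> y"
    have "((\<lambda>x. scale_fun f x + ln x) has_real_derivative - 1 / f u + 1 / u) (at u)"
      using u that(1) by (auto intro!: derivative_eq_intros scale_fun_deriv)
    moreover have "f u \<le> u" using d(2)[of u] u that(1) y by (simp add: divide_simps)
    then have "- 1 / f u + 1 / u \<le> 0" using pos[of u] u that(1) by (simp add: frac_le)
    ultimately show "\<exists>D. ((\<lambda>x. scale_fun f x + ln x) has_real_derivative D) (at u) \<and> D \<le> 0"
      by blast
  qed
  define x where "x = min y (exp (scale_fun f y + ln y - t))"
  have x: "0 < x" "x \<le> y" "x \<le> exp (scale_fun f y + ln y - t)" using y by (auto simp: x_def)
  have "ln x \<le> scale_fun f y + ln y - t" using x ln_le_cancel_iff[of x "exp (scale_fun f y + ln y - t)"] by simp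
  then have "t \<le> scale_fun f x" using grow[OF x(1,2)] by linarith
  moreover have "scale_fun f 1 = 0" by (simp add: scale_fun_def)
  moreover have "\<forall>u. x \<le> u \<and> u \<le> 1 \<longrightarrow> isCont (scale_fun f) u"
    using x(1) by (intro allI impI DERIV_isCont[OF scale_fun_deriv]) auto
  ultimately have "\<exists>u\<ge>x. u \<le> 1 \<and> scale_fun f u = t"
    using IVT2[of "scale_fun f" 1 t x] x y assms by auto
  then obtain u where "x \<le> u" "scale_fun f u = t" by blast
  then show ?thesis using x(1) by (intro exI[of _ u]) auto
qed

abbreviation g :: "real \<Rightarrow> real" where "g \<equiv> scale_inv f"

lemma scale_inv_scale_fun: "0 < x \<Longrightarrow> g (scale_fun f x) = x"
  unfolding scale_inv_def using scale_fun_inj by (simp add: the_inv_into_f_f)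

lemma scale_inv_pos: "0 \<le> t \<Longrightarrow> 0 < g t"
  and scale_fun_scale_inv: "0 \<le> t \<Longrightarrow> scale_fun f (g t) = t"
  using scale_fun_onto[of t] scale_inv_scale_fun by auto

lemma scale_inv_deriv:
  assumes t: "0 < t"
  shows "(g has_real_derivative - f (g t)) (at t)"
proof -
  have gt: "0 < g t" using t by (simp add: scale_inv_pos)
  have "isCont g (scale_fun f (g t))"
  proof (rule isCont_inverse_function2[where f="scale_fun f" and x="g t" and a="g t / 2" and b="2 * g t"])
    show "g t / 2 < g t" "g t < 2 * g t" using gt by auto
    show "g (scale_fun f u) = u" "isCont (scale_fun f) u" if "g t / 2 \<le> u" "u \<le> 2 * g t" for u
      using gt that by (auto intro!: scale_inv_scale_fun DERIV_isCont[OF scale_fun_deriv])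
  qed
  then have "isCont g t" using t by (simp add: scale_fun_scale_inv)
  then have "(g has_real_derivative inverse (- 1 / f (g t))) (at t)"
    using t gt pos[OF gt] scale_fun_deriv[OF gt]
    by (intro DERIV_inverse_function[where f="scale_fun f" and a=0 and b="t + 1"])
      (auto simp: scale_fun_scale_inv)
  then show ?thesis by simp
qed

lemma scale_inv_tendsto: "filterlim g (at_right 0) at_top"
proof -
  have "(g \<longlongrightarrow> 0) at_top"
  proof (rule tendstoI)
    fix e :: real assume e: "0 < e"
    have "\<forall>\<^sub>F t in at_top. max 0 (scale_fun f e) < t" by (rule eventually_gt_at_top)
    then show "\<forall>\<^sub>F t in at_top. dist (g t) 0 < e"
    proof eventually_elim
      fix t assume t: "max 0 (scale_fun f e) < t"
      have gt: "0 < g t" "scale_fun f (g t) = t" using t by (auto intro!: scale_inv_pos scale_fun_scale_inv)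
      have "g t < e"
      proof (rule ccontr)
        assume "\<not> g t < e"
        then have "t \<le> scale_fun f e"
          using scale_fun_strict_antimono[OF e, of "g t"] gt by (cases "g t = e") auto
        then show False using t by simp
      qed
      then show "dist (g t) 0 < e" using gt(1) by simp
    qed
  qed
  moreover have "\<forall>\<^sub>F t in at_top. 0 < g t"
    using eventually_ge_at_top[of 0] by eventually_elim (rule scale_inv_pos)
  ultimately show ?thesis by (auto intro: filterlim_at_withinI)
qed

end

section \<open>The perturbed differential equation\<close>

context restoring_force
begin

lemma eventually_scale_inv_pos: "\<forall>\<^sub>F t in at_top. 0 < g t"
  using eventually_ge_at_top[of 0] by eventually_elim (rule scale_inv_pos)

lemma eventually_scale_inv_deriv: "\<forall>\<^sub>F t in at_top. (g has_real_derivative - f (g t)) (at t)"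
  using eventually_gt_at_top[of 0] by eventually_elim (rule scale_inv_deriv)

lemma scale_inv_tendsto_0: "(g \<longlongrightarrow> 0) at_top"
  using scale_inv_tendsto by (simp add: filterlim_at)

lemma force_ratio_along_scale:
  assumes "(y \<longlongrightarrow> c) at_top"
  shows "((\<lambda>t. f (y t * g t) / f (g t)) \<longlongrightarrow> signed_powr c \<beta>) at_top"
  using filterlim_compose[OF ratio_tendsto filterlim_Pair[OF scale_inv_tendsto assms]] by simp

text \<open>The natural clock of the problem is \<open>- ln g\<close>, which runs at speed \<open>f g / g\<close> and never
  stops: a function of \<open>t\<close> that drifts at a rate bounded below in this clock is unbounded.\<close>

lemma ln_scale_inv_at_top:
  assumes "0 < \<eta>"
  shows "filterlim (\<lambda>t. - \<eta> * ln (g t)) at_top at_top"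
    and "\<forall>\<^sub>F t in at_top. ((\<lambda>t. - \<eta> * ln (g t)) has_real_derivative \<eta> * (f (g t) / g t)) (at t)"
proof -
  have "filterlim (\<lambda>t. ln (g t)) at_bot at_top"
    by (rule filterlim_compose[OF ln_at_0 scale_inv_tendsto])
  then show "filterlim (\<lambda>t. - \<eta> * ln (g t)) at_top at_top"
    using filterlim_tendsto_pos_mult_at_top[OF tendsto_const assms, of "\<lambda>t. - ln (g t)" at_top]
    by (simp add: filterlim_uminus_at_top)
  show "\<forall>\<^sub>F t in at_top. ((\<lambda>t. - \<eta> * ln (g t)) has_real_derivative \<eta> * (f (g t) / g t)) (at t)"
    using eventually_scale_inv_pos eventually_scale_inv_deriv
    by eventually_elim (auto intro!: derivative_eq_intros)
qed

text \<open>If \<open>x \<sim> c g\<close> then \<open>f x\<close> is \<open>signed_powr c \<beta>\<close> times \<open>f g = - g'\<close> up to a small relative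
  error, so that \<open>P + k g\<close> is eventually monotone for \<open>k\<close> on either side of \<open>signed_powr c \<beta>\<close>.
  Monotonicity gives the convergence of \<open>P\<close> and, on comparing with the limit, its rate.\<close>

lemma integral_of_force_asymptotics:
  assumes P: "\<forall>\<^sub>F t in at_top. (P has_real_derivative f (x t)) (at t)"
    and x: "((\<lambda>t. x t / g t) \<longlongrightarrow> c) at_top"
  obtains p where "(P \<longlongrightarrow> p) at_top" "((\<lambda>t. (p - P t) / g t) \<longlongrightarrow> signed_powr c \<beta>) at_top"
proof -
  define s where "s = signed_powr c \<beta>"
  have "((\<lambda>t. f (x t / g t * g t) / f (g t)) \<longlongrightarrow> s) at_top"
    unfolding s_def by (rule force_ratio_along_scale[OF x])
  then have ratio: "((\<lambda>t. f (x t) / f (g t)) \<longlongrightarrow> s) at_top"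
    by (rule Lim_transform_eventually) (use eventually_scale_inv_pos in eventually_elim, simp)
  have mono: "\<exists>T\<ge>0. \<forall>t\<ge>T. \<forall>u\<ge>t. P u + (s + e) * g u \<le> P t + (s + e) * g t \<and>
      P t + (s - e) * g t \<le> P u + (s - e) * g u" if e: "0 < e" for e
  proof -
    have ev: "\<forall>\<^sub>F t in at_top. f (x t) \<le> (s + e) * f (g t) \<and> (s - e) * f (g t) \<le> f (x t)"
      using tendstoD[OF ratio e] eventually_scale_inv_pos
    proof eventually_elim
      fix t assume "dist (f (x t) / f (g t)) s < e" "0 < g t"
      then have "f (x t) / f (g t) \<le> s + e" "s - e \<le> f (x t) / f (g t)" "0 < f (g t)"
        using pos by (auto simp: dist_real_def abs_less_iff)
      then show "f (x t) \<le> (s + e) * f (g t) \<and> (s - e) * f (g t) \<le> f (x t)"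
        by (simp add: divide_simps)
    qed
    have "\<exists>T. \<forall>t\<ge>T. \<forall>u\<ge>t. P u + (s + e) * g u \<le> P t + (s + e) * g t"
    proof (rule eventually_antimono_of_deriv_nonpos)
      show "\<forall>\<^sub>F t in at_top. ((\<lambda>t. P t + (s + e) * g t) has_real_derivative
          f (x t) - (s + e) * f (g t)) (at t)"
        using P eventually_scale_inv_deriv by eventually_elim (auto intro!: derivative_eq_intros)
      show "\<forall>\<^sub>F t in at_top. f (x t) - (s + e) * f (g t) \<le> 0" using ev by eventually_elim simp
    qed
    then obtain T1 where T1: "\<And>t u. T1 \<le> t \<Longrightarrow> t \<le> u \<Longrightarrow> P u + (s + e) * g u \<le> P t + (s + e) * g t"
      by blast
    have "\<exists>T. \<forall>t\<ge>T. \<forall>u\<ge>t. - (P u + (s - e) * g u) \<le> - (P t + (s - e) * g t)"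
    proof (rule eventually_antimono_of_deriv_nonpos)
      show "\<forall>\<^sub>F t in at_top. ((\<lambda>t. - (P t + (s - e) * g t)) has_real_derivative
          - (f (x t) - (s - e) * f (g t))) (at t)"
        using P eventually_scale_inv_deriv by eventually_elim (auto intro!: derivative_eq_intros)
      show "\<forall>\<^sub>F t in at_top. - (f (x t) - (s - e) * f (g t)) \<le> 0" using ev by eventually_elim simp
    qed
    then obtain T2 where T2: "\<And>t u. T2 \<le> t \<Longrightarrow> t \<le> u \<Longrightarrow>
        - (P u + (s - e) * g u) \<le> - (P t + (s - e) * g t)" by blast
    show ?thesis
    proof (intro exI[of _ "max 0 (max T1 T2)"] conjI allI impI)
      fix t u assume "max 0 (max T1 T2) \<le> t" "t \<le> u"
      then show "P u + (s + e) * g u \<le> P t + (s + e) * g t"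
        "P t + (s - e) * g t \<le> P u + (s - e) * g u" using T1[of t u] T2[of t u] by auto
    qed simp
  qed
  obtain T where T: "0 \<le> T" "\<And>t u. T \<le> t \<Longrightarrow> t \<le> u \<Longrightarrow> P u + (s + 1) * g u \<le> P t + (s + 1) * g t"
    "\<And>t u. T \<le> t \<Longrightarrow> t \<le> u \<Longrightarrow> P t + (s - 1) * g t \<le> P u + (s - 1) * g u"
    using mono[of 1] by auto
  have "P T + (s - 1) * g T \<le> P t + (s + 1) * g t" if "T \<le> t" for t
  proof -
    have "(s - 1) * g t \<le> (s + 1) * g t"
      using scale_inv_pos[of t] that T(1) by (intro mult_right_mono) auto
    then show ?thesis using T(3)[of T t] that by simp
  qed
  then obtain p where "((\<lambda>t. P t + (s + 1) * g t) \<longlongrightarrow> p) at_top"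
    using convergent_of_antimono_bdd_below[of T "\<lambda>t. P t + (s + 1) * g t"] T(2) by blast
  then have "((\<lambda>t. P t + (s + 1) * g t - (s + 1) * g t) \<longlongrightarrow> p - (s + 1) * 0) at_top"
    by (intro tendsto_intros scale_inv_tendsto_0)
  then have p: "(P \<longlongrightarrow> p) at_top" by simp
  have "((\<lambda>t. (p - P t) / g t) \<longlongrightarrow> s) at_top"
  proof (rule tendstoI)
    fix r :: real assume "0 < r"
    define e where "e = r / 2"
    have e: "0 < e" "e < r" using \<open>0 < r\<close> by (auto simp: e_def)
    obtain T where T: "0 \<le> T" "\<And>t u. T \<le> t \<Longrightarrow> t \<le> u \<Longrightarrow> P u + (s + e) * g u \<le> P t + (s + e) * g t"
      "\<And>t u. T \<le> t \<Longrightarrow> t \<le> u \<Longrightarrow> P t + (s - e) * g t \<le> P u + (s - e) * g u"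
      using mono[OF e(1)] by auto
    have lims: "((\<lambda>u. P u + k * g u) \<longlongrightarrow> p) at_top" for k
      by (rule tendsto_eq_intros p scale_inv_tendsto_0 refl | simp)+
    show "\<forall>\<^sub>F t in at_top. dist ((p - P t) / g t) s < r"
      using eventually_ge_at_top[of T]
    proof eventually_elim
      fix t assume t: "T \<le> t"
      have "p \<le> P t + (s + e) * g t"
      proof (rule tendsto_upperbound[OF lims])
        show "\<forall>\<^sub>F u in at_top. P u + (s + e) * g u \<le> P t + (s + e) * g t"
          using eventually_ge_at_top[of t] by eventually_elim (rule T(2)[OF t])
      qed simp
      moreover have "P t + (s - e) * g t \<le> p"
      proof (rule tendsto_lowerbound[OF lims])
        show "\<forall>\<^sub>F u in at_top. P t + (s - e) * g t \<le> P u + (s - e) * g u"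
          using eventually_ge_at_top[of t] by eventually_elim (rule T(3)[OF t])
      qed simp
      moreover have "0 < g t" using t T(1) by (simp add: scale_inv_pos)
      ultimately have "(p - P t) / g t \<le> s + e" "s - e \<le> (p - P t) / g t"
        by (simp_all add: divide_simps)
      then show "dist ((p - P t) / g t) s < r" using e by (auto simp: dist_real_def)
    qed
  qed
  then show thesis using p that by (simp add: s_def)
qed

text \<open>The normalised solution cannot escape to infinity. If it did, \<open>N\<close> would be negligible against
  \<open>Y\<close>, so the force would always point towards 0 and drive \<open>Y\<close> to 0. But near 0 Potter's bound
  with an exponent \<open>\<alpha> > 1\<close> says that the force on \<open>u\<close> times the scale \<open>g\<close> exceeds the force on
  \<open>g\<close> by a factor of order \<open>u powr \<alpha>\<close>, more than the factor \<open>u\<close> at which the normalisation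
  expands, and so \<open>u\<close> would be decreasing. The sign \<open>s\<close> treats both infinities at once.\<close>

lemma no_faster_than_scale:
  assumes s: "s \<in> {-1, 1}"
    and Y: "\<forall>\<^sub>F t in at_top. (Y has_real_derivative - f (Y t - N t)) (at t)"
    and N: "((\<lambda>t. N t / g t) \<longlongrightarrow> 0) at_top"
  shows "\<not> filterlim (\<lambda>t. s * (Y t / g t)) at_top at_top"
proof
  assume inf: "filterlim (\<lambda>t. s * (Y t / g t)) at_top at_top"
  have ss: "s * s = 1" using s by auto
  define u where "u t = s * (Y t / g t)" for t
  define w where "w t = s * ((Y t - N t) / g t)" for t
  have w_half: "\<forall>\<^sub>F t in at_top. u t / 2 \<le> w t \<and> 2 \<le> u t"
  proof -
    have "\<forall>\<^sub>F t in at_top. dist (N t / g t) 0 < 1" by (rule tendstoD[OF N]) simp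
    moreover have "\<forall>\<^sub>F t in at_top. 2 \<le> u t"
      using inf unfolding u_def filterlim_at_top by blast
    ultimately show ?thesis
    proof eventually_elim
      case (elim t)
      have "w t = u t - s * (N t / g t)" by (simp add: w_def u_def diff_divide_distrib algebra_simps)
      moreover have "\<bar>N t / g t\<bar> < 1" using elim(1) by (simp only: dist_real_def diff_0_right)
      then have "s * (N t / g t) \<le> 1" using s by (auto simp only: abs_less_iff)
      ultimately show ?case using elim(2) by simp
    qed
  qed
  define V where "V t = s * Y t" for t
  define x where "x t = w t * g t" for t
  have x_eq: "\<forall>\<^sub>F t in at_top. Y t - N t = s * x t"
    using eventually_scale_inv_pos by eventually_elim (simp add: x_def w_def ss flip: mult.assoc)
  have x_pos: "\<forall>\<^sub>F t in at_top. 0 < x t"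
    using w_half eventually_scale_inv_pos by eventually_elim (simp add: x_def)
  have V_pos: "\<forall>\<^sub>F t in at_top. 0 < V t"
    using w_half eventually_scale_inv_pos
  proof eventually_elim
    case (elim t)
    have "V t = u t * g t" using elim(2) by (simp add: V_def u_def)
    then show ?case using elim by simp
  qed
  have V_deriv: "\<forall>\<^sub>F t in at_top. (V has_real_derivative - (s * f (s * x t))) (at t)"
    using Y x_eq unfolding V_def by eventually_elim (auto intro!: derivative_eq_intros)
  have spos: "0 < s * f (s * a)" if "0 < a" for a
    using s pos[OF that] neg[of "- a"] that by auto
  have "\<exists>T. \<forall>t\<ge>T. \<forall>u\<ge>t. V u \<le> V t"
    by (rule eventually_antimono_of_deriv_nonpos[OF V_deriv])
      (use x_pos in eventually_elim, use spos in \<open>simp add: less_imp_le\<close>)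
  then obtain T1 where T1: "\<And>t u. T1 \<le> t \<Longrightarrow> t \<le> u \<Longrightarrow> V u \<le> V t" by blast
  obtain T2 where T2: "\<And>t. T2 \<le> t \<Longrightarrow> 0 < V t" using V_pos by (auto simp: eventually_at_top_linorder)
  obtain v where v: "(V \<longlongrightarrow> v) at_top"
    using convergent_of_antimono_bdd_below[of "max T1 T2" V 0] T1 T2 by (auto simp: less_imp_le)
  have "((\<lambda>t. N t / g t * g t) \<longlongrightarrow> 0 * 0) at_top"
    by (intro tendsto_intros N scale_inv_tendsto_0)
  then have N0: "(N \<longlongrightarrow> 0) at_top"
    unfolding mult_zero_left
    by (rule Lim_transform_eventually) (use eventually_scale_inv_pos in eventually_elim, simp)
  have "((\<lambda>t. V t - s * N t) \<longlongrightarrow> v - s * 0) at_top" by (intro tendsto_intros v N0)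
  moreover have "\<forall>\<^sub>F t in at_top. V t - s * N t = x t"
    using eventually_scale_inv_pos by eventually_elim (simp add: x_def w_def V_def right_diff_distrib)
  ultimately have xv: "(x \<longlongrightarrow> v) at_top" by (simp add: Lim_transform_eventually)
  have "v = 0"
  proof (rule ccontr)
    assume "v \<noteq> 0"
    moreover have "0 \<le> v" by (rule tendsto_lowerbound[OF v]) (use V_pos in \<open>auto elim: eventually_mono\<close>)
    ultimately have "0 < v" by simp
    define k where "k = s * f (s * v)"
    have k: "0 < k" using spos[OF \<open>0 < v\<close>] by (simp add: k_def)
    have "isCont f (s * v)" using continuous by (simp add: continuous_on_eq_continuous_at)
    then have "((\<lambda>t. f (s * x t)) \<longlongrightarrow> f (s * v)) at_top"
      by (rule isCont_tendsto_compose) (intro tendsto_intros xv)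
    then have "((\<lambda>t. s * f (s * x t)) \<longlongrightarrow> k) at_top" unfolding k_def by (intro tendsto_intros)
    then have "\<forall>\<^sub>F t in at_top. k / 2 < s * f (s * x t)" using k by (intro order_tendstoD) auto
    then have ge: "\<forall>\<^sub>F t in at_top. k / 2 \<le> - (- (s * f (s * x t)))" by (rule eventually_mono) simp
    have "filterlim (\<lambda>t. - V t) at_top at_top"
    proof (rule filterlim_at_top_of_deriv_ge[OF _ _ ge])
      show "\<forall>\<^sub>F t in at_top. ((\<lambda>t. - V t) has_real_derivative - (- (s * f (s * x t)))) (at t)"
        using V_deriv by eventually_elim (rule DERIV_minus)
      show "\<forall>\<^sub>F t in at_top. ((\<lambda>t. k / 2 * t) has_real_derivative k / 2) (at t)"
        by (intro always_eventually allI) (auto intro!: derivative_eq_intros)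
      show "filterlim (\<lambda>t. k / 2 * t) at_top at_top"
        using k by (intro filterlim_tendsto_pos_mult_at_top[OF tendsto_const _ filterlim_ident]) auto
    qed
    then have "\<forall>\<^sub>F t in at_top. 0 \<le> - V t" unfolding filterlim_at_top by blast
    then have "\<forall>\<^sub>F t::real in at_top. False" using V_pos by eventually_elim simp
    then show False by simp
  qed
  then have x0: "filterlim x (at_right 0) at_top"
    using xv x_pos by (auto intro: filterlim_at_withinI)
  \<comment> \<open>any exponent strictly between 1 and \<open>\<beta>\<close> serves\<close>
  define \<alpha> where "\<alpha> = (1 + \<beta>) / 2"
  have \<alpha>: "1 < \<alpha>" "\<alpha> < \<beta>" using index by (auto simp: \<alpha>_def)
  then obtain C r where C: "0 < C" "0 < r"
    "\<And>x l. 0 < x \<Longrightarrow> x < r \<Longrightarrow> 0 < l \<Longrightarrow> l \<le> 1 \<Longrightarrow> f (l * x) \<le> C * l powr \<alpha> * f x"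
    using potter_bound[of \<alpha>] by auto
  have "((\<lambda>a. s * f (s * a) / f a) \<longlongrightarrow> 1) (at_right 0)"
  proof (cases "s = 1")
    case True
    have "\<forall>\<^sub>F a in at_right 0. 1 = f a / f a"
      using eventually_at_right_less[of "0::real"]
      by eventually_elim (use pos in \<open>simp add: less_imp_neq[THEN not_sym]\<close>)
    then show ?thesis using True by (simp add: Lim_transform_eventually[OF tendsto_const])
  next
    case False
    then have "s = -1" using s by simp
    then show ?thesis using tendsto_minus[OF odd] by simp
  qed
  then have "\<forall>\<^sub>F a in at_right 0. 1 / 2 < s * f (s * a) / f a" by (rule order_tendstoD) simp
  then have half: "\<forall>\<^sub>F t in at_top. 1 / 2 < s * f (s * x t) / f (x t)"
    by (rule eventually_compose_filterlim[OF _ x0])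
  have xr: "\<forall>\<^sub>F t in at_top. x t < r"
    using order_tendstoD(2)[of x 0] xv \<open>v = 0\<close> C(2) by auto
  have big: "\<forall>\<^sub>F t in at_top. (2 * C) * 2 powr \<alpha> \<le> u t powr (\<alpha> - 1)"
  proof -
    define K where "K = (2 * C) * 2 powr \<alpha>"
    have K: "0 < K" using C(1) by (simp add: K_def)
    have "\<forall>\<^sub>F t in at_top. K powr (1 / (\<alpha> - 1)) \<le> u t"
      using inf unfolding u_def filterlim_at_top by blast
    then have "\<forall>\<^sub>F t in at_top. K \<le> u t powr (\<alpha> - 1)"
    proof eventually_elim
      case (elim t)
      then have "(K powr (1 / (\<alpha> - 1))) powr (\<alpha> - 1) \<le> u t powr (\<alpha> - 1)"
        using \<alpha> by (intro powr_mono2) auto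
      then show ?case using \<alpha> K by (simp add: powr_powr)
    qed
    then show ?thesis by (simp add: K_def)
  qed
  have u_deriv: "\<forall>\<^sub>F t in at_top. (u has_real_derivative
      (f (g t) / g t) * (u t - s * f (s * x t) / f (g t))) (at t)"
    using V_deriv eventually_scale_inv_deriv eventually_scale_inv_pos
  proof eventually_elim
    case (elim t)
    have "((\<lambda>t. V t / g t) has_real_derivative (- (s * f (s * x t)) * g t - V t * (- f (g t))) / (g t * g t)) (at t)"
      using elim by (intro DERIV_divide) auto
    moreover have "(- (s * f (s * x t)) * g t - V t * (- f (g t))) / (g t * g t)
        = (f (g t) / g t) * (u t - s * f (s * x t) / f (g t))"
      using elim(3) pos[OF elim(3)] by (simp add: u_def V_def field_simps)
    moreover have "(\<lambda>t. V t / g t) = u" by (simp add: fun_eq_iff V_def u_def)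
    ultimately show ?case by simp
  qed
  have "\<exists>T. \<forall>t\<ge>T. \<forall>v\<ge>t. u v \<le> u t"
  proof (rule eventually_antimono_of_deriv_nonpos[OF u_deriv])
    show "\<forall>\<^sub>F t in at_top. f (g t) / g t * (u t - s * f (s * x t) / f (g t)) \<le> 0"
      using w_half eventually_scale_inv_pos half xr big x_pos
    proof eventually_elim
      case (elim t)
      have w: "1 \<le> w t" "u t / 2 \<le> w t" "0 < u t" using elim(1) by auto
      have fx: "0 < f (x t)" "0 < f (g t)" using pos elim by auto
      have "f (1 / w t * x t) \<le> C * (1 / w t) powr \<alpha> * f (x t)"
        using w elim by (intro C(3)) auto
      then have "f (g t) \<le> C * f (x t) / w t powr \<alpha>"
        using w by (simp add: x_def powr_divide)
      then have "w t powr \<alpha> * f (g t) \<le> C * f (x t)"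
        using w by (simp add: divide_simps mult.commute)
      moreover have "(u t / 2) powr \<alpha> \<le> w t powr \<alpha>" using w \<alpha> by (intro powr_mono2) auto
      ultimately have 1: "(u t / 2) powr \<alpha> * f (g t) \<le> C * f (x t)"
        using fx by (meson mult_right_mono less_imp_le order_trans)
      have "(2 * C) * u t \<le> (u t / 2) powr \<alpha>"
      proof -
        have "(2 * C) * 2 powr \<alpha> * u t \<le> u t powr (\<alpha> - 1) * u t"
          using elim(5) w by (intro mult_right_mono) auto
        also have "\<dots> = u t powr \<alpha>" using w by (simp add: powr_diff)
        finally show ?thesis by (simp add: powr_divide divide_simps mult_ac)
      qed
      then have "(2 * C) * u t * f (g t) \<le> C * f (x t)"
        using 1 fx by (meson mult_right_mono less_imp_le order_trans)
      then have "C * (2 * (u t * f (g t))) \<le> C * f (x t)" by (simp add: mult_ac)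
      then have "2 * (u t * f (g t)) \<le> f (x t)" using C(1) by (simp add: mult_le_cancel_left_pos)
      moreover have "f (x t) < 2 * (s * f (s * x t))" using elim(3) fx by (simp add: divide_simps)
      ultimately have "u t \<le> s * f (s * x t) / f (g t)"
        using fx by (simp add: divide_simps)
      then show ?case using fx elim(2) by (intro mult_nonneg_nonpos) auto
    qed
  qed
  then obtain T where T: "\<And>t. T \<le> t \<Longrightarrow> u t \<le> u T" by blast
  have "\<forall>\<^sub>F t in at_top. u T < u t" using inf unfolding u_def filterlim_at_top_dense by blast
  then have "\<forall>\<^sub>F t in at_top. u T < u t \<and> T \<le> t" using eventually_ge_at_top by (rule eventually_conj)
  then show False using T eventually_happens[of _ "at_top :: real filter"] by force
qed

text \<open>The normalised solution \<open>z = Y / g\<close> obeys \<open>z' = (f g / g) D\<close>, where \<open>D\<close> is close to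
  \<open>c - signed_powr c \<beta>\<close> whenever \<open>z\<close> is close to \<open>c\<close>. Away from the three equilibria, levels are
  crossed in one direction only, hence \<open>z\<close> converges. A limit that is not an equilibrium would
  leave \<open>z\<close> with a persistent drift in the clock \<open>- ln g\<close>.\<close>

lemma perturbed_ode_limit:
  assumes Y: "\<forall>\<^sub>F t in at_top. (Y has_real_derivative - f (Y t - N t)) (at t)"
    and N: "((\<lambda>t. N t / g t) \<longlongrightarrow> 0) at_top"
  shows "\<exists>c\<in>{-1, 0, 1}. ((\<lambda>t. Y t / g t) \<longlongrightarrow> c) at_top"
proof -
  define z where "z t = Y t / g t" for t
  define n where "n t = N t / g t" for t
  define D where "D t = z t - f ((z t - n t) * g t) / f (g t)" for t
  have n: "(n \<longlongrightarrow> 0) at_top" using N by (simp add: n_def[abs_def])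
  have deriv: "\<forall>\<^sub>F t in at_top. (z has_real_derivative (f (g t) / g t) * D t) (at t)"
    using Y eventually_scale_inv_deriv eventually_scale_inv_pos
  proof eventually_elim
    case (elim t)
    have "((\<lambda>t. Y t / g t) has_real_derivative (- f (Y t - N t) * g t - Y t * (- f (g t))) / (g t * g t)) (at t)"
      using elim by (intro DERIV_divide) auto
    moreover have "(z t - n t) * g t = Y t - N t" using elim(3) by (simp add: z_def n_def left_diff_distrib)
    then have D_eq: "D t = Y t / g t - f (Y t - N t) / f (g t)" by (simp only: D_def z_def)
    have "(- f (Y t - N t) * g t - Y t * (- f (g t))) / (g t * g t) = (f (g t) / g t) * D t"
      unfolding D_eq using elim(3) pos[OF elim(3)] by (simp add: field_simps)
    ultimately show ?case by (simp add: z_def[abs_def])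
  qed
  have limD: "((\<lambda>t. y t - f ((y t - n t) * g t) / f (g t)) \<longlongrightarrow> c - signed_powr c \<beta>) at_top"
    if "(y \<longlongrightarrow> c) at_top" for y c
  proof -
    have "((\<lambda>t. y t - n t) \<longlongrightarrow> c) at_top" using tendsto_diff[OF that n] by simp
    then show ?thesis by (intro tendsto_diff that force_ratio_along_scale)
  qed
  have rate_pos: "\<forall>\<^sub>F t in at_top. 0 < f (g t) / g t"
    using eventually_scale_inv_pos by eventually_elim (simp add: pos)
  have one_sided: "(\<forall>\<^sub>F t in at_top. c \<le> z t) \<or> (\<forall>\<^sub>F t in at_top. z t \<le> c)"
    if c: "c \<notin> {-1, 0, 1}" for c
  proof -
    have lim: "((\<lambda>t. c - f ((c - n t) * g t) / f (g t)) \<longlongrightarrow> c - signed_powr c \<beta>) at_top"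
      by (rule limD) (rule tendsto_const)
    have "c - signed_powr c \<beta> \<noteq> 0" using signed_powr_eq_self_iff[of \<beta> c] c index by auto
    then consider "0 < c - signed_powr c \<beta>" | "c - signed_powr c \<beta> < 0" by linarith
    then show ?thesis
    proof cases
      case 1
      have "\<forall>\<^sub>F t in at_top. z t = c \<longrightarrow> 0 < f (g t) / g t * D t"
        using order_tendstoD(1)[OF lim 1] rate_pos
      proof eventually_elim
        case (elim t)
        then show ?case unfolding D_def by (intro impI mult_pos_pos) auto
      qed
      with deriv show ?thesis by (rule one_sided_of_crossing_upwards)
    next
      case 2
      have "\<forall>\<^sub>F t in at_top. z t = c \<longrightarrow> f (g t) / g t * D t < 0"
        using order_tendstoD(2)[OF lim 2] rate_pos
      proof eventually_elim
        case (elim t)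
        then show ?case unfolding D_def by (intro impI mult_pos_neg) auto
      qed
      with deriv show ?thesis by (rule one_sided_of_crossing_downwards)
    qed
  qed
  have "(\<exists>c. (z \<longlongrightarrow> c) at_top) \<or> filterlim z at_top at_top \<or> filterlim z at_bot at_top"
    by (rule convergent_of_one_sided[of "{-1, 0, 1}"]) (use one_sided in auto)
  moreover have "\<not> filterlim z at_top at_top"
    using no_faster_than_scale[OF _ Y N, of 1] by (simp add: z_def[abs_def])
  moreover have "\<not> filterlim z at_bot at_top"
    using no_faster_than_scale[OF _ Y N, of "-1"] by (simp add: z_def[abs_def] filterlim_uminus_at_top)
  ultimately obtain c where c: "(z \<longlongrightarrow> c) at_top" by blast
  have no_drift: "\<not> 0 < s * (c - signed_powr c \<beta>)" for s
  proof
    define \<eta> where "\<eta> = s * (c - signed_powr c \<beta>) / 2"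
    assume "0 < s * (c - signed_powr c \<beta>)"
    then have \<eta>: "0 < \<eta>" "\<eta> < s * (c - signed_powr c \<beta>)" by (auto simp: \<eta>_def)
    have "((\<lambda>t. s * D t) \<longlongrightarrow> s * (c - signed_powr c \<beta>)) at_top"
      unfolding D_def by (intro tendsto_mult tendsto_const limD c)
    then have "\<forall>\<^sub>F t in at_top. \<eta> < s * D t" using \<eta>(2) by (rule order_tendstoD)
    then have le: "\<forall>\<^sub>F t in at_top. \<eta> * (f (g t) / g t) \<le> s * (f (g t) / g t * D t)"
      using rate_pos
    proof eventually_elim
      case (elim t)
      then have "\<eta> * (f (g t) / g t) \<le> (s * D t) * (f (g t) / g t)"
        by (intro mult_right_mono) auto
      then show ?case by (simp add: mult_ac)
    qed
    have "filterlim (\<lambda>t. s * z t) at_top at_top"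
    proof (rule filterlim_at_top_of_deriv_ge[OF _ ln_scale_inv_at_top(2)[OF \<eta>(1)] le
          ln_scale_inv_at_top(1)[OF \<eta>(1)]])
      show "\<forall>\<^sub>F t in at_top. ((\<lambda>t. s * z t) has_real_derivative s * (f (g t) / g t * D t)) (at t)"
        using deriv by eventually_elim (rule DERIV_cmult)
    qed
    moreover have "((\<lambda>t. s * z t) \<longlongrightarrow> s * c) at_top" by (intro tendsto_intros c)
    ultimately show False
      using not_tendsto_and_filterlim_at_infinity[of at_top "\<lambda>t. s * z t" "s * c"]
      by (auto simp: filterlim_at_top_imp_at_infinity)
  qed
  have "signed_powr c \<beta> = c"
    using no_drift[of 1] no_drift[of "-1"] by simp
  then have "c \<in> {-1, 0, 1}" using signed_powr_eq_self_iff[of \<beta> c] index by auto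
  then show ?thesis using c unfolding z_def[abs_def] by blast
qed

end

section \<open>Paths of the stochastic equation\<close>

lemma has_real_derivative_set_integral:
  fixes h :: "real \<Rightarrow> real"
  assumes h: "continuous_on {0..} h" and t: "0 < t"
  shows "((\<lambda>t. LINT s:{0..t}|lborel. h s) has_real_derivative h t) (at t)"
proof -
  have "(LINT s:{0..u}|lborel. h s) = integral {0..u} h" for u
    by (intro set_borel_integral_eq_integral(2) borel_integrable_atLeastAtMost' continuous_on_subset[OF h]) auto
  moreover have "((\<lambda>u. integral {0..u} h) has_real_derivative h t) (at t within {0..t + 1})"
    using t by (intro integral_has_real_derivative continuous_on_subset[OF h]) auto
  ultimately show ?thesis using t by (simp add: at_within_Icc_at)
qed

context restoring_force
begin

lemma integrated_force_deriv:
  assumes "continuous_on {0..} x"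
  shows "\<forall>\<^sub>F t in at_top. ((\<lambda>t. LINT s:{0..t}|lborel. f (x s)) has_real_derivative f (x t)) (at t)"
proof -
  have "continuous_on {0..} (\<lambda>s. f (x s))"
    by (rule continuous_on_compose2[OF continuous assms]) simp
  note deriv = has_real_derivative_set_integral[OF this]
  show ?thesis using eventually_gt_at_top[of 0] by eventually_elim (rule deriv)
qed

text \<open>A path is not differentiable, but adding the tail \<open>l - i t\<close> of the noise to it leaves only the
  integrated force, and the tail itself is the small perturbation inside the force.\<close>

lemma path_limit_of_small_tail:
  assumes x: "continuous_on {0..} x"
    and eq: "\<And>t. 0 \<le> t \<Longrightarrow> x t = \<xi> - (LINT s:{0..t}|lborel. f (x s)) + i t"
    and tail: "((\<lambda>t. (l - i t) / g t) \<longlongrightarrow> 0) at_top"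
  shows "\<exists>c\<in>{-1, 0, 1}. ((\<lambda>t. x t / g t) \<longlongrightarrow> c) at_top"
proof -
  define Y where "Y t = \<xi> + l - (LINT s:{0..t}|lborel. f (x s))" for t
  have Y_eq: "\<forall>\<^sub>F t in at_top. x t = Y t - (l - i t)"
    using eventually_ge_at_top[of 0] by eventually_elim (simp add: eq Y_def)
  have "\<forall>\<^sub>F t in at_top. (Y has_real_derivative - f (Y t - (l - i t))) (at t)"
    using integrated_force_deriv[OF x] Y_eq
    unfolding Y_def by eventually_elim (auto intro!: derivative_eq_intros)
  then obtain c where c: "c \<in> {-1, 0, 1}" "((\<lambda>t. Y t / g t) \<longlongrightarrow> c) at_top"
    using perturbed_ode_limit[OF _ tail] by blast
  have "((\<lambda>t. Y t / g t - (l - i t) / g t) \<longlongrightarrow> c - 0) at_top"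
    by (intro tendsto_diff c tail)
  moreover have "\<forall>\<^sub>F t in at_top. Y t / g t - (l - i t) / g t = x t / g t"
    using Y_eq by eventually_elim (simp flip: diff_divide_distrib)
  ultimately have "((\<lambda>t. x t / g t) \<longlongrightarrow> c) at_top" by (simp add: Lim_transform_eventually)
  then show ?thesis using c(1) by blast
qed

text \<open>Conversely the tail of the noise is the tail of the integrated force minus the path, and both
  are known to leading order.\<close>

lemma tail_limit_of_path_limit:
  assumes x: "continuous_on {0..} x"
    and eq: "\<And>t. 0 \<le> t \<Longrightarrow> x t = \<xi> - (LINT s:{0..t}|lborel. f (x s)) + i t"
    and lim: "((\<lambda>t. x t / g t) \<longlongrightarrow> c) at_top"
  shows "\<exists>l. (i \<longlongrightarrow> l) at_top \<and> ((\<lambda>t. (l - i t) / g t) \<longlongrightarrow> signed_powr c \<beta> - c) at_top"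
proof -
  define P where "P t = (LINT s:{0..t}|lborel. f (x s))" for t
  obtain p where p: "(P \<longlongrightarrow> p) at_top" "((\<lambda>t. (p - P t) / g t) \<longlongrightarrow> signed_powr c \<beta>) at_top"
    using integral_of_force_asymptotics[OF _ lim, of P] integrated_force_deriv[OF x]
    unfolding P_def by blast
  have i: "\<forall>\<^sub>F t in at_top. x t - \<xi> + P t = i t"
    using eventually_ge_at_top[of 0] by eventually_elim (simp add: eq P_def)
  have "((\<lambda>t. x t / g t * g t) \<longlongrightarrow> c * 0) at_top"
    by (intro tendsto_mult lim scale_inv_tendsto_0)
  moreover have "\<forall>\<^sub>F t in at_top. x t / g t * g t = x t"
    using eventually_scale_inv_pos by eventually_elim simp
  ultimately have "(x \<longlongrightarrow> 0) at_top" by (simp add: Lim_transform_eventually)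
  then have "((\<lambda>t. x t - \<xi> + P t) \<longlongrightarrow> 0 - \<xi> + p) at_top" by (intro tendsto_intros p(1))
  then have "(i \<longlongrightarrow> p - \<xi>) at_top" using i by (simp add: Lim_transform_eventually)
  moreover have "((\<lambda>t. (p - P t) / g t - x t / g t) \<longlongrightarrow> signed_powr c \<beta> - c) at_top"
    by (intro tendsto_diff p(2) lim)
  moreover have "\<forall>\<^sub>F t in at_top. (p - P t) / g t - x t / g t = (p - \<xi> - i t) / g t"
    using i by eventually_elim (simp add: algebra_simps flip: diff_divide_distrib add_divide_distrib)
  ultimately show ?thesis by (blast intro: Lim_transform_eventually)
qed

end

section \<open>Almost sure limits of the stochastic integral\<close>

lemma energy_mono:
  assumes "continuous_on {0..} \<sigma>" "s \<le> t"
  shows "energy \<sigma> s \<le> energy \<sigma> t"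
  unfolding energy_def using assms(2)
  by (intro integral_mono integrable_square_indicator assms(1)) (auto simp: indicator_def)

lemma set_integrable_of_energy_bounded:
  assumes \<sigma>: "continuous_on {0..} \<sigma>" and K: "\<And>n::nat. energy \<sigma> (real n) \<le> K"
  shows "set_integrable lborel {0..} (\<lambda>s. (\<sigma> s)\<^sup>2)"
proof -
  have "incseq (\<lambda>n. energy \<sigma> (real n))" by (intro incseq_SucI energy_mono[OF \<sigma>]) simp
  then obtain e where e: "(\<lambda>n. energy \<sigma> (real n)) \<longlonglongrightarrow> e"
    using incseq_convergent[of "\<lambda>n. energy \<sigma> (real n)" K] K by blast
  have "(\<lambda>x. indicator {0..} x *\<^sub>R (\<sigma> x)\<^sup>2) \<in> borel_measurable borel"
    by (intro borel_measurable_continuous_on_indicator continuous_intros \<sigma>) auto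
  then have meas: "(\<lambda>x. (\<sigma> x)\<^sup>2 * indicator {0..} x) \<in> borel_measurable lborel"
    by (simp add: mult.commute)
  have "integrable lborel (\<lambda>x. (\<sigma> x)\<^sup>2 * indicator {0..} x)"
  proof (rule integrable_monotone_convergence[OF _ _ _ _ meas])
    show "integrable lborel (\<lambda>s. (\<sigma> s)\<^sup>2 * indicator {0..real n} s)" for n
      by (rule integrable_square_indicator[OF \<sigma>])
    show "AE x in lborel. mono (\<lambda>n. (\<sigma> x)\<^sup>2 * indicator {0..real n} x)"
      by (intro AE_I2 monoI mult_left_mono) (auto simp: indicator_def)
    have "(\<lambda>n. (\<sigma> x)\<^sup>2 * indicator {0..real n} x) \<longlonglongrightarrow> (\<sigma> x)\<^sup>2 * indicator {0..} x" for x
    proof (rule tendsto_eventually)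
      obtain n where "x \<le> real n" using real_arch_simple by blast
      then show "\<forall>\<^sub>F n in sequentially. (\<sigma> x)\<^sup>2 * indicator {0..real n} x = (\<sigma> x)\<^sup>2 * indicator {0..} x"
        by (intro eventually_sequentiallyI[of n]) (auto simp: indicator_def)
    qed
    then show "AE x in lborel. (\<lambda>n. (\<sigma> x)\<^sup>2 * indicator {0..real n} x) \<longlonglongrightarrow> (\<sigma> x)\<^sup>2 * indicator {0..} x"
      by simp
    show "(\<lambda>n. LINT x|lborel. (\<sigma> x)\<^sup>2 * indicator {0..real n} x) \<longlonglongrightarrow> e"
      using e by (simp add: energy_def)
  qed
  then show ?thesis by (simp add: set_integrable_def mult.commute)
qed

context prob_space
begin

lemma tendsto_expectation_cos:
  assumes [measurable]: "\<And>n::nat. Z n \<in> borel_measurable M" "Z' \<in> borel_measurable M"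
    and "AE \<omega> in M. (\<lambda>n. Z n \<omega>) \<longlonglongrightarrow> (Z' \<omega> :: real)"
  shows "(\<lambda>n. expectation (\<lambda>\<omega>. cos (Z n \<omega>))) \<longlonglongrightarrow> expectation (\<lambda>\<omega>. cos (Z' \<omega>))"
proof (rule integral_dominated_convergence[where w="\<lambda>_. 1"])
  show "AE \<omega> in M. (\<lambda>n. cos (Z n \<omega>)) \<longlonglongrightarrow> cos (Z' \<omega>)"
    using assms(3) by eventually_elim (rule tendsto_cos)
qed auto

lemma AE_tendsto_lim:
  assumes "AE \<omega> in M. \<exists>l. (\<lambda>n. Z n \<omega>) \<longlonglongrightarrow> (l::real)"
  shows "AE \<omega> in M. (\<lambda>n. Z n \<omega>) \<longlonglongrightarrow> lim (\<lambda>n. Z n \<omega>)"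
  using assms by eventually_elim (metis limI)

text \<open>For a Gaussian increment of large variance \<open>E cos\<close> is close to 0, whereas convergence makes
  the increments after a suitable time \<open>m\<close> so small that \<open>E cos\<close> stays above \<open>1 / 2\<close>.\<close>

lemma ito_convergent_imp_energy_bounded:
  assumes bm: "standard_brownian_motion M B" and \<sigma>: "continuous_on {0..} \<sigma>"
    and I: "\<And>t. 0 \<le> t \<Longrightarrow> is_ito_integral M B \<sigma> t (I t)"
    and conv: "AE \<omega> in M. \<exists>l. ((\<lambda>t. I t \<omega>) \<longlongrightarrow> l) at_top"
  shows "\<exists>K. \<forall>n::nat. energy \<sigma> (real n) \<le> K"
proof -
  define Z where "Z n = I (real n)" for n :: nat
  define l where "l \<omega> = lim (\<lambda>n. Z n \<omega>)" for \<omega>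
  have [measurable]: "Z n \<in> borel_measurable M" for n
    using I[of "real n"] by (simp add: Z_def is_ito_integral_def)
  have [measurable]: "l \<in> borel_measurable M" unfolding l_def by measurable
  have Zl: "AE \<omega> in M. (\<lambda>n. Z n \<omega>) \<longlonglongrightarrow> l \<omega>"
    unfolding l_def
  proof (rule AE_tendsto_lim)
    show "AE \<omega> in M. \<exists>l. (\<lambda>n. Z n \<omega>) \<longlonglongrightarrow> l"
      using conv
    proof eventually_elim
      case (elim \<omega>)
      then obtain l where "((\<lambda>t. I t \<omega>) \<longlongrightarrow> l) at_top" by blast
      then have "(\<lambda>n. Z n \<omega>) \<longlonglongrightarrow> l"
        unfolding Z_def by (rule filterlim_compose[OF _ filterlim_real_sequentially])
      then show ?case ..
    qed
  qed
  have "AE \<omega> in M. (\<lambda>m. l \<omega> - Z m \<omega>) \<longlonglongrightarrow> 0"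
    using Zl
  proof eventually_elim
    case (elim \<omega>)
    then show ?case using tendsto_diff[OF tendsto_const elim, of "l \<omega>"] by simp
  qed
  then have "(\<lambda>m. expectation (\<lambda>\<omega>. cos (l \<omega> - Z m \<omega>))) \<longlonglongrightarrow> expectation (\<lambda>\<omega>. cos 0)"
    by (intro tendsto_expectation_cos) auto
  then have "\<forall>\<^sub>F m in sequentially. 1 / 2 < expectation (\<lambda>\<omega>. cos (l \<omega> - Z m \<omega>))"
    by (intro order_tendstoD(1)[where y="expectation (\<lambda>\<omega>. cos 0)"]) (auto simp: prob_space)
  then obtain m where m: "1 / 2 < expectation (\<lambda>\<omega>. cos (l \<omega> - Z m \<omega>))"
    by (auto simp: eventually_sequentially)
  have "AE \<omega> in M. (\<lambda>n. Z n \<omega> - Z m \<omega>) \<longlonglongrightarrow> l \<omega> - Z m \<omega>"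
    using Zl by eventually_elim (intro tendsto_intros)
  then have "(\<lambda>n. expectation (\<lambda>\<omega>. cos (Z n \<omega> - Z m \<omega>))) \<longlonglongrightarrow> expectation (\<lambda>\<omega>. cos (l \<omega> - Z m \<omega>))"
    by (intro tendsto_expectation_cos) auto
  then have "\<forall>\<^sub>F n in sequentially. 1 / 2 < expectation (\<lambda>\<omega>. cos (Z n \<omega> - Z m \<omega>))"
    using m by (rule order_tendstoD)
  then obtain N where N: "\<And>n. n \<ge> N \<Longrightarrow> 1 / 2 < expectation (\<lambda>\<omega>. cos (Z n \<omega> - Z m \<omega>))"
    by (auto simp: eventually_sequentially)
  have "energy \<sigma> (real n) \<le> energy \<sigma> (real m) + 2 * ln 2" for n
  proof -
    define n' where "n' = max n (max N m)"
    have n': "n \<le> n'" "N \<le> n'" "m \<le> n'" by (auto simp: n'_def)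
    have "1 / 2 < exp (- (energy \<sigma> (real n') - energy \<sigma> (real m)) / 2)"
      using N[OF n'(2)] n'(3)
        ito_increments_gaussian[OF bm \<sigma> I, of "real m" "real n'" "real n'" 1 0]
      by (simp add: Z_def)
    then have "ln (1 / 2) < - (energy \<sigma> (real n') - energy \<sigma> (real m)) / 2"
      by (subst (asm) ln_less_cancel_iff[symmetric]) auto
    then have "energy \<sigma> (real n') \<le> energy \<sigma> (real m) + 2 * ln 2"
      by (simp add: ln_div)
    moreover have "energy \<sigma> (real n) \<le> energy \<sigma> (real n')" using n' by (intro energy_mono[OF \<sigma>]) simp
    ultimately show ?thesis by linarith
  qed
  then show ?thesis by blast
qed

text \<open>For one \<open>\<theta>\<close> the hypothesis only confines \<open>\<theta> Z\<close> to the multiples of \<open>2 \<pi>\<close>; small values of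
  \<open>\<theta>\<close> exclude all of these but 0.\<close>

lemma AE_eq_0_of_expectation_cos_eq_1:
  assumes [measurable]: "Z \<in> borel_measurable M"
    and one: "\<And>\<theta>. expectation (\<lambda>\<omega>. cos (\<theta> * Z \<omega>)) = 1"
  shows "AE \<omega> in M. Z \<omega> = (0::real)"
proof -
  have "AE \<omega> in M. cos (\<theta> * Z \<omega>) = 1" for \<theta>
  proof -
    have int: "integrable M (\<lambda>\<omega>. cos (\<theta> * Z \<omega>))"
      by (rule integrable_const_bound[of _ 1]) auto
    then have "expectation (\<lambda>\<omega>. 1 - cos (\<theta> * Z \<omega>)) = 0" using one[of \<theta>] by (simp add: prob_space)
    then have "AE \<omega> in M. 1 - cos (\<theta> * Z \<omega>) = 0"
      using int by (subst (asm) integral_nonneg_eq_0_iff_AE) auto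
    then show ?thesis by eventually_elim simp
  qed
  then have "AE \<omega> in M. \<forall>k. cos (1 / real (Suc k) * Z \<omega>) = 1"
    by (simp only: AE_all_countable) blast
  then show ?thesis
  proof eventually_elim
    case (elim \<omega>)
    obtain k where k: "\<bar>Z \<omega>\<bar> \<le> real k" using real_arch_simple by blast
    define y where "y = \<bar>1 / real (Suc k) * Z \<omega>\<bar>"
    have y: "0 \<le> y" "y \<le> 1" using k by (auto simp: y_def abs_mult divide_simps)
    have "cos y = cos (1 / real (Suc k) * Z \<omega>)"
      by (cases "1 / real (Suc k) * Z \<omega> < 0") (simp_all only: y_def abs_if cos_minus if_True if_False)
    then have "cos y = cos 0" using elim by simp
    then have "y = 0" using y pi_gt3 cos_inj_pi[of y 0] by simp
    then show ?case by (simp add: y_def)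
  qed
qed

text \<open>Along times \<open>t n\<close> at which \<open>g\<close> drops by ever larger factors, the normalised tail and the
  normalised increment \<open>D n\<close> to the next time have the same limit. The \<open>D n\<close> are centred Gaussian
  with independent neighbours, so \<open>D n - D (n + 1)\<close>, which tends to 0, has as variance the sum of
  the two variances. Hence these tend to 0, and so does \<open>D n\<close>. This takes the place of a zero-one
  law.\<close>

lemma normalised_ito_tail_limit_eq_0:
  assumes bm: "standard_brownian_motion M B" and \<sigma>: "continuous_on {0..} \<sigma>"
    and I: "\<And>t. 0 \<le> t \<Longrightarrow> is_ito_integral M B \<sigma> t (I t)"
    and g_pos: "\<And>t. 0 \<le> t \<Longrightarrow> 0 < g t" and g_lim: "(g \<longlongrightarrow> (0::real)) at_top"
    and conv: "AE \<omega> in M. ((\<lambda>t. (l \<omega> - I t \<omega>) / g t) \<longlongrightarrow> L \<omega>) at_top"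
  shows "AE \<omega> in M. L \<omega> = 0"
proof -
  have "\<exists>y. (0 \<le> y \<and> real (Suc n) \<le> y) \<and> x + 1 \<le> y \<and> g y \<le> g x / real (Suc n)"
    if "0 \<le> x \<and> real n \<le> x" for x n
  proof -
    have "0 < g x / real (Suc n)" using g_pos that by simp
    then have "\<forall>\<^sub>F y in at_top. g y < g x / real (Suc n)" by (rule order_tendstoD(2)[OF g_lim])
    then obtain T where T: "\<And>y. T \<le> y \<Longrightarrow> g y < g x / real (Suc n)"
      by (auto simp: eventually_at_top_linorder)
    show ?thesis using T[of "max T (x + 1)"] that by (intro exI[of _ "max T (x + 1)"]) auto
  qed
  then have "\<exists>t. \<forall>n. (0 \<le> t n \<and> real n \<le> t n) \<and> t n + 1 \<le> t (Suc n) \<and> g (t (Suc n)) \<le> g (t n) / real (Suc n)"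
    by (intro dependent_nat_choice) (auto intro: exI[of _ 0])
  then obtain t where t: "\<And>n. 0 \<le> t n" "\<And>n. real n \<le> t n" "\<And>n. t n + 1 \<le> t (Suc n)"
    "\<And>n. g (t (Suc n)) \<le> g (t n) / real (Suc n)" by blast
  have t_less: "t n \<le> t (Suc n)" for n using t(3)[of n] by simp
  have t_inf: "filterlim t at_top sequentially"
    by (rule filterlim_at_top_mono[OF filterlim_real_sequentially]) (simp add: t)
  have ratio: "(\<lambda>n. g (t (Suc n)) / g (t n)) \<longlonglongrightarrow> 0"
  proof (rule tendsto_sandwich[OF _ _ tendsto_const])
    show "\<forall>\<^sub>F n in sequentially. 0 \<le> g (t (Suc n)) / g (t n)"
      using g_pos t(1) by (intro always_eventually allI divide_nonneg_pos less_imp_le) auto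
    show "\<forall>\<^sub>F n in sequentially. g (t (Suc n)) / g (t n) \<le> inverse (real (Suc n))"
      using g_pos[OF t(1)] t(4) by (intro always_eventually allI) (simp add: divide_simps mult.commute)
  qed (rule LIMSEQ_inverse_real_of_nat)
  define D where "D n \<omega> = (I (t (Suc n)) \<omega> - I (t n) \<omega>) / g (t n)" for n \<omega>
  define s where "s n = (energy \<sigma> (t (Suc n)) - energy \<sigma> (t n)) / (g (t n))\<^sup>2" for n
  have s_nonneg: "0 \<le> s n" for n
    using energy_mono[OF \<sigma> t_less[of n]] by (simp add: s_def)
  have [measurable]: "I (t n) \<in> borel_measurable M" for n
    using I[OF t(1)] by (simp add: is_ito_integral_def)
  have [measurable]: "D n \<in> borel_measurable M" for n unfolding D_def by measurable
  have DL: "AE \<omega> in M. (\<lambda>n. D n \<omega>) \<longlonglongrightarrow> L \<omega>"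
    using conv
  proof eventually_elim
    case (elim \<omega>)
    define V where "V n = (l \<omega> - I (t n) \<omega>) / g (t n)" for n
    have V: "V \<longlonglongrightarrow> L \<omega>" unfolding V_def by (rule filterlim_compose[OF elim t_inf])
    then have "(\<lambda>n. V n - V (Suc n) * (g (t (Suc n)) / g (t n))) \<longlonglongrightarrow> L \<omega> - L \<omega> * 0"
      by (intro tendsto_diff tendsto_mult ratio LIMSEQ_Suc)
    moreover have "V n - V (Suc n) * (g (t (Suc n)) / g (t n)) = D n \<omega>" for n
      using g_pos[OF t(1), of n] g_pos[OF t(1), of "Suc n"] by (simp add: V_def D_def field_simps)
    ultimately show ?case by simp
  qed
  have "AE \<omega> in M. (\<lambda>n. D n \<omega> - D (Suc n) \<omega>) \<longlonglongrightarrow> 0"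
    using DL
  proof eventually_elim
    case (elim \<omega>)
    then show ?case using tendsto_diff[OF elim LIMSEQ_Suc[OF elim]] by simp
  qed
  then have "(\<lambda>n. expectation (\<lambda>\<omega>. cos (D n \<omega> - D (Suc n) \<omega>))) \<longlonglongrightarrow> expectation (\<lambda>\<omega>. cos 0)"
    by (intro tendsto_expectation_cos) auto
  moreover have "expectation (\<lambda>\<omega>. cos (D n \<omega> - D (Suc n) \<omega>)) = exp (- (s n + s (Suc n)) / 2)" for n
    using ito_increments_gaussian[OF bm \<sigma> I t(1)[of n] t_less[of n] t_less[of "Suc n"],
        where a="1 / g (t n)" and b="- 1 / g (t (Suc n))"]
    by (simp add: D_def s_def power_divide)
  ultimately have "(\<lambda>n. exp (- (s n + s (Suc n)) / 2)) \<longlonglongrightarrow> 1" by (simp add: prob_space)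
  then have "(\<lambda>n. ln (exp (- (s n + s (Suc n)) / 2))) \<longlonglongrightarrow> ln 1" by (rule tendsto_ln) simp
  then have "(\<lambda>n. (- 2) * ln (exp (- (s n + s (Suc n)) / 2))) \<longlonglongrightarrow> (- 2) * ln 1"
    by (intro tendsto_mult tendsto_const)
  moreover have "(- 2) * ln (exp (- (s n + s (Suc n)) / 2)) = s n + s (Suc n)" for n by simp
  ultimately have sum0: "(\<lambda>n. s n + s (Suc n)) \<longlonglongrightarrow> 0" by (simp only: ln_one mult_zero_right)
  have s0: "s \<longlonglongrightarrow> 0"
    by (rule tendsto_sandwich[OF _ _ tendsto_const sum0]) (auto simp: s_nonneg)
  \<comment> \<open>\<open>L\<close> need not be measurable; the pointwise limit of the \<open>D n\<close> is\<close>
  define D' where "D' \<omega> = lim (\<lambda>n. D n \<omega>)" for \<omega>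
  have [measurable]: "D' \<in> borel_measurable M" unfolding D'_def by measurable
  have DD': "AE \<omega> in M. (\<lambda>n. D n \<omega>) \<longlonglongrightarrow> D' \<omega>"
    unfolding D'_def by (rule AE_tendsto_lim) (use DL in eventually_elim, blast)
  have "expectation (\<lambda>\<omega>. cos (\<theta> * D' \<omega>)) = 1" for \<theta>
  proof -
    have "AE \<omega> in M. (\<lambda>n. \<theta> * D n \<omega>) \<longlonglongrightarrow> \<theta> * D' \<omega>"
      using DD' by eventually_elim (intro tendsto_intros)
    then have "(\<lambda>n. expectation (\<lambda>\<omega>. cos (\<theta> * D n \<omega>))) \<longlonglongrightarrow> expectation (\<lambda>\<omega>. cos (\<theta> * D' \<omega>))"
      by (intro tendsto_expectation_cos) auto
    moreover have "expectation (\<lambda>\<omega>. cos (\<theta> * D n \<omega>)) = exp (- (\<theta>\<^sup>2 * s n) / 2)" for n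
      using ito_increments_gaussian[OF bm \<sigma> I t(1)[of n] t_less[of n] t_less[of "Suc n"],
          where a="\<theta> / g (t n)" and b=0]
      by (simp add: D_def s_def power_divide)
    moreover have "(\<lambda>n. exp (- (\<theta>\<^sup>2 * s n) / 2)) \<longlonglongrightarrow> exp (- (\<theta>\<^sup>2 * 0) / 2)"
      by (intro tendsto_intros s0) simp
    ultimately show ?thesis by (simp add: LIMSEQ_unique)
  qed
  then have "AE \<omega> in M. D' \<omega> = 0" by (intro AE_eq_0_of_expectation_cos_eq_1) auto
  with DL DD' show ?thesis by eventually_elim (metis LIMSEQ_unique)
qed

lemma prob_eq_1_iff_AE:
  assumes "complete_measure M"
  shows "prob {\<omega> \<in> space M. P \<omega>} = 1 \<longleftrightarrow> (AE \<omega> in M. P \<omega>)"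
proof
  assume one: "prob {\<omega> \<in> space M. P \<omega>} = 1"
  then have "{\<omega> \<in> space M. P \<omega>} \<in> events" using measure_notin_sets by force
  then show "AE \<omega> in M. P \<omega>" using one prob_eq_1[of "{\<omega> \<in> space M. P \<omega>}"] by simp
next
  assume P: "AE \<omega> in M. P \<omega>"
  then obtain N where N: "{\<omega> \<in> space M. \<not> P \<omega>} \<subseteq> N" "N \<in> null_sets M"
    by (auto elim!: AE_E simp: null_sets_def)
  then have "{\<omega> \<in> space M. \<not> P \<omega>} \<in> events"
    using complete_measure.complete[OF assms] by blast
  then have "space M - {\<omega> \<in> space M. \<not> P \<omega>} \<in> events" by blast
  moreover have "space M - {\<omega> \<in> space M. \<not> P \<omega>} = {\<omega> \<in> space M. P \<omega>}" by blast
  ultimately have "{\<omega> \<in> space M. P \<omega>} \<in> events" by simp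
  then show "prob {\<omega> \<in> space M. P \<omega>} = 1" using P by (subst prob_eq_1) auto
qed

end

section \<open>Characterisation of the decay rate\<close>

lemma continuous_of_locally_lipschitz:
  fixes f :: "real \<Rightarrow> real"
  assumes "\<And>x. \<exists>u>0. \<exists>L. L-lipschitz_on (cball x u) f"
  shows "continuous_on UNIV f"
proof (intro continuous_at_imp_continuous_on ballI)
  fix x :: real
  obtain u L where u: "u > 0" "L-lipschitz_on (cball x u) f" using assms by blast
  then show "isCont f x"
    using lipschitz_on_continuous_on[OF u(2)] by (intro continuous_on_interior) (auto simp: u(1))
qed

lemma asymptotically_odd:
  fixes f \<phi> :: "real \<Rightarrow> real"
  assumes odd: "\<And>x. \<phi> (- x) = - \<phi> x" and lim: "((\<lambda>x. f x / \<phi> x) \<longlongrightarrow> 1) (at 0)"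
  shows "((\<lambda>x. f (- x) / f x) \<longlongrightarrow> -1) (at_right 0)"
proof -
  have r: "((\<lambda>x. f x / \<phi> x) \<longlongrightarrow> 1) (at_right 0)"
    using lim by (simp add: filterlim_at_split)
  have "filterlim uminus (at_left 0) (at_right (0::real))"
    using filterlim_at_left_to_right[of uminus "at_left 0" "0::real"] by (simp add: at_left_minus filterlim_def)
  then have "((\<lambda>x. f (- x) / \<phi> (- x)) \<longlongrightarrow> 1) (at_right 0)"
    using lim filterlim_compose[of "\<lambda>x. f x / \<phi> x" "nhds 1" "at_left 0" uminus] by (simp add: filterlim_at_split)
  then have "((\<lambda>x. - ((f (- x) / \<phi> (- x)) / (f x / \<phi> x))) \<longlongrightarrow> - (1 / 1)) (at_right 0)"
    by (intro tendsto_minus tendsto_divide r) auto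
  moreover have "\<forall>\<^sub>F x in at_right 0. 0 < f x / \<phi> x" by (rule order_tendstoD(1)[OF r]) simp
  then have "\<forall>\<^sub>F x in at_right 0. - ((f (- x) / \<phi> (- x)) / (f x / \<phi> x)) = f (- x) / f x"
    by eventually_elim (auto simp: odd)
  ultimately show ?thesis by (simp add: Lim_transform_eventually)
qed

theorem theorem11:
  fixes M :: "'a measure"
    and B I X :: "real \<Rightarrow> 'a \<Rightarrow> real"
    and f \<sigma> :: "real \<Rightarrow> real"
    and \<xi> \<beta> :: real
  assumes "prob_space M" and "complete_measure M"
    and "standard_brownian_motion M B"
    and "\<And>x. \<exists>u>0. \<exists>L. L-lipschitz_on (cball x u) f"
    and "f 0 = 0" and "\<And>x. x \<noteq> 0 \<Longrightarrow> x * f x > 0"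
    and "\<exists>\<phi> :: real \<Rightarrow> real. (\<forall>x. \<phi> (- x) = - \<phi> x) \<and> ((\<lambda>x. f x / \<phi> x) \<longlongrightarrow> 1) (at 0)"
    and "\<beta> > 1" and "f \<in> RV0 \<beta>"
    and "((\<lambda>x. f x / x) \<longlongrightarrow> 0) (at_right 0)"
    and "continuous_on {0..} \<sigma>"
    and "ito_integral_process M B \<sigma> I"
    and "sde_solution M B I f \<xi> X"
  defines "a \<equiv> set_integrable lborel {0..} (\<lambda>s. (\<sigma> s)\<^sup>2) \<and>
      (AE \<omega> in M. ((\<lambda>t. ito_tail I t \<omega> / scale_inv f t) \<longlongrightarrow> 0) at_top)"
    and "b \<equiv> measure M {\<omega> \<in> space M.
      \<exists>L::real. ((\<lambda>t. X t \<omega> / scale_inv f t) \<longlongrightarrow> L) at_top} = 1"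
    and "c \<equiv> measure M {\<omega> \<in> space M.
      \<exists>L\<in>{-1, 0, 1}. ((\<lambda>t. X t \<omega> / scale_inv f t) \<longlongrightarrow> L) at_top} = 1"
  shows "(a \<longleftrightarrow> b) \<and> (b \<longleftrightarrow> c)"
proof -
  interpret prob_space M by fact
  interpret restoring_force f \<beta>
  proof
    show cont: "continuous_on UNIV f" by (rule continuous_of_locally_lipschitz) fact
    show "continuous_on {0<..} f" by (rule continuous_on_subset[OF cont]) simp
    show "0 < f x" if "0 < x" for x using assms(6)[of x] that by (simp add: zero_less_mult_iff)
    show "f x < 0" if "x < 0" for x using assms(6)[of x] that by (simp add: zero_less_mult_iff)
    show "((\<lambda>x. f (k * x) / f x) \<longlongrightarrow> k powr \<beta>) (at_right 0)" if "0 < k" for k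
      using assms(9) that by (simp add: RV0_def)
    show "((\<lambda>x. f (- x) / f x) \<longlongrightarrow> -1) (at_right 0)"
      using assms(7) asymptotically_odd[of _ f] by blast
  qed fact+
  have I: "is_ito_integral M B \<sigma> t (I t)" if "0 \<le> t" for t
    using assms(12) that by (simp add: ito_integral_process_def)
  have path: "AE \<omega> in M. continuous_on {0..} (\<lambda>t. X t \<omega>) \<and>
      (\<forall>t\<ge>0. X t \<omega> = \<xi> - (LINT s:{0..t}|lborel. f (X s \<omega>)) + I t \<omega>)"
    using assms(13) by (simp add: sde_solution_def continuous_adapted_def)
  have b_iff: "b \<longleftrightarrow> (AE \<omega> in M. \<exists>L. ((\<lambda>t. X t \<omega> / g t) \<longlongrightarrow> L) at_top)"
    unfolding b_def by (rule prob_eq_1_iff_AE) fact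
  have c_iff: "c \<longleftrightarrow> (AE \<omega> in M. \<exists>L\<in>{-1, 0, 1}. ((\<lambda>t. X t \<omega> / g t) \<longlongrightarrow> L) at_top)"
    unfolding c_def by (rule prob_eq_1_iff_AE) fact
  have "b" if c
    using that unfolding b_iff c_iff by eventually_elim blast
  \<comment> \<open>the tail is \<open>Lim - I t\<close> with one and the same number \<open>Lim\<close> for all \<open>t\<close>, and this is all
     that the pathwise result asks of \<open>Lim\<close>\<close>
  moreover have "c" if a
  proof -
    have "AE \<omega> in M. ((\<lambda>t. ito_tail I t \<omega> / g t) \<longlongrightarrow> 0) at_top" using that by (simp add: a_def)
    with path show ?thesis unfolding c_iff
    proof eventually_elim
      case (elim \<omega>)
      then show ?case unfolding ito_tail_def by (intro path_limit_of_small_tail) auto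
    qed
  qed
  moreover have "a" if b
  proof -
    define L where "L \<omega> = Lim at_top (\<lambda>t. X t \<omega> / g t)" for \<omega>
    have tail: "AE \<omega> in M. (\<exists>l. ((\<lambda>t. I t \<omega>) \<longlongrightarrow> l) at_top) \<and>
        ((\<lambda>t. ito_tail I t \<omega> / g t) \<longlongrightarrow> signed_powr (L \<omega>) \<beta> - L \<omega>) at_top"
      using path that[unfolded b_iff]
    proof eventually_elim
      case (elim \<omega>)
      then have "((\<lambda>t. X t \<omega> / g t) \<longlongrightarrow> L \<omega>) at_top"
        unfolding L_def by (auto simp: tendsto_Lim)
      with elim obtain l where l: "((\<lambda>t. I t \<omega>) \<longlongrightarrow> l) at_top"
        "((\<lambda>t. (l - I t \<omega>) / g t) \<longlongrightarrow> signed_powr (L \<omega>) \<beta> - L \<omega>) at_top"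
        using tail_limit_of_path_limit[of "\<lambda>t. X t \<omega>" \<xi> "\<lambda>t. I t \<omega>" "L \<omega>"] by auto
      moreover have "Lim at_top (\<lambda>t. I t \<omega>) = l" using l(1) by (auto intro: tendsto_Lim)
      ultimately show ?case by (auto simp: ito_tail_def)
    qed
    have "AE \<omega> in M. signed_powr (L \<omega>) \<beta> - L \<omega> = 0"
    proof (rule normalised_ito_tail_limit_eq_0[OF assms(3,11) I scale_inv_pos scale_inv_tendsto_0])
      show "AE \<omega> in M. ((\<lambda>t. (Lim at_top (\<lambda>T. I T \<omega>) - I t \<omega>) / g t)
          \<longlongrightarrow> signed_powr (L \<omega>) \<beta> - L \<omega>) at_top"
        using tail unfolding ito_tail_def by eventually_elim blast
    qed
    with tail have "AE \<omega> in M. ((\<lambda>t. ito_tail I t \<omega> / g t) \<longlongrightarrow> 0) at_top"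
      by eventually_elim simp
    moreover have "AE \<omega> in M. \<exists>l. ((\<lambda>t. I t \<omega>) \<longlongrightarrow> l) at_top"
      using tail by eventually_elim blast
    then have "\<exists>K. \<forall>n::nat. energy \<sigma> (real n) \<le> K"
      using ito_convergent_imp_energy_bounded[OF assms(3,11) I] by blast
    then have "set_integrable lborel {0..} (\<lambda>s. (\<sigma> s)\<^sup>2)"
      using set_integrable_of_energy_bounded[OF assms(11)] by blast
    ultimately show ?thesis by (simp add: a_def)
  qed
  ultimately show ?thesis by blast
qed

end
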